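(* Let $\delta$ be a locally nilpotent derivation of $\mathbb{C}[x_1,\ldots,x_n]$ that defines a free action of $(\mathbb{C},+)$ on $\mathbb{C}^n$ of degree $d$, and let $x\in\mathbb{C}^n$. If $\mathbb{C}.x$ is a generic orbit (i.e. $(\delta^d x_j)(x)\neq 0$ for at least one $j\in\{1,\ldots,n\}$), then the Chow point $p(x)$ of the projective curve $C_x=\overline{\mathbb{C}.x}\subset\mathbb{P}_n\mathbb{C}$ is the class of the polynomial $$P(x)=\det\bigl(F_{lk}(x)\bigr)_{1\le l\le d,\;0\le k\le d-1},$$ where, for $l,k\in\{0,\ldots,d\}$, $$F_{lk}(x)=\sum_{r=0}^{\min\{d-l,k\}} f_{l+r,\,k-r}(x)\prod_{j=0}^{d-l-r-1}(d-j)\prod_{j=0}^{r-1}(k-j),$$ $$f_{lk}(x)=\sum_{j=0}^n\beta_j(\delta^lx_j)(x)\sum_{j=0}^n\alpha_j(\delta^kx_j)(x)-\sum_{j=0}^n\alpha_j(\delta^lx_j)(x)\sum_{j=0}^n\beta_j(\delta^kx_j)(x).$$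
   Context: Conventions: $x_1,\ldots,x_n$ are the coordinates on $X=\mathbb{C}^n$, and $x_0:=1$ (so $\delta^0x_0=1$ and $\delta^l x_0=0$ for $l>0$). $\delta^0$ is the identity, empty products equal $1$. $X$ is embedded in $\mathbb{P}_n\mathbb{C}$ (homogeneous coordinates $X_0,\ldots,X_n$) by $x\mapsto[1:x_1(x):\ldots:x_n(x)]$. A locally nilpotent derivation $\delta$ of $\mathbb{C}[X]=\mathbb{C}[x_1,\ldots,x_n]$ defines an algebraic action of $(\mathbb{C},+)$ on $X$ by $x_k(-t.x)=\sum_{j\ge 0}\frac{t^j}{j!}(\delta^jx_k)(x)$ for $t\in\mathbb{C}$, $x\in X$, $k=1,\dots,n$. The degree of $\delta$ (and of the action) is the smallest $d$ such that $\delta^{d+1}(x_j)=0$ for all $j$. $C_x$ denotes the closure in $\mathbb{P}_n\mathbb{C}$ of the orbit $\mathbb{C}.x$. Chow point: let $\alpha_0,\ldots,\alpha_n$ and $\beta_0,\ldots,\beta_n$ be two sets of variables (homogeneous coordinates on the two factors of $\mathbb{P}_n\mathbb{C}\times\mathbb{P}_n\mathbb{C}$), and for $\alpha\in\mathbb{P}_n\mathbb{C}$ let $H_\alpha=\{\sum_{j=0}^n\alpha_jX_j=0\}\subset\mathbb{P}_n\mathbb{C}$. The Chow point of an irreducible projective curve $C\subset\mathbb{P}_n\mathbb{C}$ of degree $d$ is the bihomogeneous polynomial of bidegree $(d,d)$ in $(\alpha,\beta)$, determined up to a nonzero scalar, that defines the hypersurface $H_C=\bigcup_{y\in C}\{(\alpha,\beta):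 y\in H_\alpha\cap H_\beta\}\subset\mathbb{P}_n\mathbb{C}\times\mathbb{P}_n\mathbb{C}$; it is regarded as an element of the projectivization of the vector space of bihomogeneous polynomials of bidegree $(d,d)$. The closure of a generic orbit is a curve of degree $d$. *)

theory Defs
  imports Complex_Main "HOL-Library.Poly_Mapping" "Jordan_Normal_Form.Determinant"
begin

section \<open>Polynomials with complex coefficients\<close>

text \<open>The ring structure (convolution product) is the one of the library type of finitely
  supported functions; exponent vectors are finitely supported functions into \<^typ>\<open>nat\<close>.\<close>

type_synonym 'v cpoly = "('v \<Rightarrow>\<^sub>0 nat) \<Rightarrow>\<^sub>0 complex"

definition cconst :: "complex \<Rightarrow> 'v cpoly" where
  "cconst c = Poly_Mapping.single 0 c"

definition cvar :: "'v \<Rightarrow> 'v cpoly" where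
  "cvar i = Poly_Mapping.single (Poly_Mapping.single i 1) 1"

definition ceval :: "('v::finite \<Rightarrow> complex) \<Rightarrow> 'v cpoly \<Rightarrow> complex" where
  "ceval x p = (\<Sum>m\<in>Poly_Mapping.keys p.
     Poly_Mapping.lookup p m * (\<Prod>i\<in>UNIV. x i ^ Poly_Mapping.lookup m i))"

definition homogeneous :: "nat \<Rightarrow> ('v::finite) cpoly \<Rightarrow> bool" where
  "homogeneous k p \<longleftrightarrow>
     (\<forall>m\<in>Poly_Mapping.keys p. (\<Sum>i\<in>UNIV. Poly_Mapping.lookup m i) = k)"

definition bihomogeneous :: "nat \<Rightarrow> nat \<Rightarrow> ('v::finite + 'w::finite) cpoly \<Rightarrow> bool" where
  "bihomogeneous k l p \<longleftrightarrow>
     (\<forall>m\<in>Poly_Mapping.keys p.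
        (\<Sum>i\<in>UNIV. Poly_Mapping.lookup m (Inl i)) = k \<and>
        (\<Sum>i\<in>UNIV. Poly_Mapping.lookup m (Inr i)) = l)"

definition cpoly_class :: "'v cpoly \<Rightarrow> 'v cpoly set" where
  "cpoly_class p = {cconst c * p |c. c \<noteq> 0}"


section \<open>Projective space\<close>

text \<open>A point of the projective space with homogeneous coordinates indexed by \<open>'v\<close> is the
  set of all its vectors of homogeneous coordinates.\<close>

type_synonym 'v ppoint = "('v \<Rightarrow> complex) set"

definition proj_pt :: "('v \<Rightarrow> complex) \<Rightarrow> 'v ppoint" where
  "proj_pt v = {(\<lambda>i. c * v i) |c. c \<noteq> 0}"

definition proj_space :: "('v::finite) ppoint set" where
  "proj_space = {proj_pt v |v. v \<noteq> (\<lambda>_. 0)}"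

definition proj_zeros :: "('v::finite) cpoly set \<Rightarrow> 'v ppoint set" where
  "proj_zeros S = {y \<in> proj_space. \<forall>p\<in>S. \<forall>v\<in>y. ceval v p = 0}"

definition zariski_closed :: "('v::finite) ppoint set \<Rightarrow> bool" where
  "zariski_closed Z \<longleftrightarrow> (\<exists>S. (\<forall>p\<in>S. \<exists>k. homogeneous k p) \<and> Z = proj_zeros S)"

definition irreducible_closed :: "('v::finite) ppoint set \<Rightarrow> bool" where
  "irreducible_closed Z \<longleftrightarrow> zariski_closed Z \<and> Z \<noteq> {} \<and>
     (\<forall>A B. zariski_closed A \<and> zariski_closed B \<and> Z \<subseteq> A \<union> B \<longrightarrow> Z \<subseteq> A \<or> Z \<subseteq> B)"

text \<open>Irreducible closed of Krull dimension one: the longest chains of irreducible closed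
  subsets have exactly two members.\<close>

definition irreducible_curve :: "('v::finite) ppoint set \<Rightarrow> bool" where
  "irreducible_curve C \<longleftrightarrow> irreducible_closed C \<and>
     (\<exists>Z. irreducible_closed Z \<and> Z \<subset> C) \<and>
     \<not> (\<exists>Y Z. irreducible_closed Y \<and> irreducible_closed Z \<and> Y \<subset> Z \<and> Z \<subset> C)"

definition hyperplane :: "('v::finite) ppoint \<Rightarrow> 'v ppoint set" where
  "hyperplane \<alpha> = {y \<in> proj_space. \<forall>a\<in>\<alpha>. \<forall>v\<in>y. (\<Sum>j\<in>UNIV. a j * v j) = 0}"

text \<open>The degree of a curve is the number of points in which a generic hyperplane meets it;
  generic means outside a proper hypersurface \<open>G = 0\<close> of the dual projective space.\<close>

definition has_degree :: "('v::finite) ppoint set \<Rightarrow> nat \<Rightarrow> bool" where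
  "has_degree C d \<longleftrightarrow> (\<exists>G k. homogeneous k G \<and> G \<noteq> 0 \<and>
     (\<forall>\<alpha>\<in>proj_space - proj_zeros {G}.
        finite (C \<inter> hyperplane \<alpha>) \<and> card (C \<inter> hyperplane \<alpha>) = d))"


section \<open>Chow points of curves\<close>

text \<open>The variables \<open>\<alpha>\<^sub>j\<close> and \<open>\<beta>\<^sub>j\<close> are indexed by \<open>Inl j\<close> and \<open>Inr j\<close>.\<close>

definition biproj_zeros :: "('v::finite + 'v) cpoly \<Rightarrow> ('v ppoint \<times> 'v ppoint) set" where
  "biproj_zeros Q = {(\<alpha>, \<beta>) \<in> proj_space \<times> proj_space.
     \<forall>a\<in>\<alpha>. \<forall>b\<in>\<beta>. ceval (case_sum a b) Q = 0}"

definition chow_hypersurface :: "('v::finite) ppoint set \<Rightarrow> ('v ppoint \<times> 'v ppoint) set" where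
  "chow_hypersurface C = (\<Union>y\<in>C. {(\<alpha>, \<beta>) \<in> proj_space \<times> proj_space.
     y \<in> hyperplane \<alpha> \<inter> hyperplane \<beta>})"

text \<open>All bihomogeneous equations of the right bidegree; for an irreducible curve this set is
  a single \<^const>\<open>cpoly_class\<close>, i.e. a point of the projectivized space of polynomials.\<close>

definition chow_point :: "('v::finite) ppoint set \<Rightarrow> ('v + 'v) cpoly set" where
  "chow_point C = {Q. irreducible_curve C \<and> Q \<noteq> 0 \<and>
     (\<exists>d. has_degree C d \<and> bihomogeneous d d Q) \<and> biproj_zeros Q = chow_hypersurface C}"


section \<open>Locally nilpotent derivations and their actions\<close>

definition derivation :: "('n cpoly \<Rightarrow> 'n cpoly) \<Rightarrow> bool" where
  "derivation \<delta> \<longleftrightarrow>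
     (\<forall>p q. \<delta> (p + q) = \<delta> p + \<delta> q) \<and>
     (\<forall>c p. \<delta> (cconst c * p) = cconst c * \<delta> p) \<and>
     (\<forall>p q. \<delta> (p * q) = \<delta> p * q + p * \<delta> q)"

definition locally_nilpotent :: "('n cpoly \<Rightarrow> 'n cpoly) \<Rightarrow> bool" where
  "locally_nilpotent \<delta> \<longleftrightarrow> (\<forall>p. \<exists>m. (\<delta> ^^ m) p = 0)"

definition lnd_degree :: "('n::finite cpoly \<Rightarrow> 'n cpoly) \<Rightarrow> nat" where
  "lnd_degree \<delta> = (LEAST d. \<forall>j. (\<delta> ^^ (d + 1)) (cvar j) = 0)"

text \<open>The sign comes from the convention
  \<open>x\<^sub>k(-t.x) = (\<Sum>j. t ^ j / j! * (\<delta> ^^ j) x\<^sub>k (x))\<close>; the series has finitely many nonzero terms.\<close>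

definition lnd_action ::
  "('n::finite cpoly \<Rightarrow> 'n cpoly) \<Rightarrow> complex \<Rightarrow> ('n \<Rightarrow> complex) \<Rightarrow> ('n \<Rightarrow> complex)" where
  "lnd_action \<delta> t x = (\<lambda>k. suminf (\<lambda>j. (- t) ^ j / fact j * ceval x ((\<delta> ^^ j) (cvar k))))"

definition free_action :: "(complex \<Rightarrow> ('n \<Rightarrow> complex) \<Rightarrow> ('n \<Rightarrow> complex)) \<Rightarrow> bool" where
  "free_action act \<longleftrightarrow> (\<forall>t x. act t x = x \<longrightarrow> t = 0)"

text \<open>The index set \<open>{0, \<dots>, n}\<close> is \<open>'n option\<close>, with \<^const>\<open>None\<close> in the role of \<open>0\<close>.\<close>

definition affine_embed :: "('n::finite \<Rightarrow> complex) \<Rightarrow> 'n option ppoint" where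
  "affine_embed x = proj_pt (case_option 1 x)"

definition orbit_closure ::
  "('n::finite cpoly \<Rightarrow> 'n cpoly) \<Rightarrow> ('n \<Rightarrow> complex) \<Rightarrow> 'n option ppoint set" where
  "orbit_closure \<delta> x = zariski_closed hull (affine_embed ` range (\<lambda>t. lnd_action \<delta> t x))"


section \<open>The determinantal polynomial\<close>

definition coord :: "'n option \<Rightarrow> 'n cpoly" where
  "coord = case_option 1 cvar"

definition alpha_form ::
  "('n::finite cpoly \<Rightarrow> 'n cpoly) \<Rightarrow> ('n \<Rightarrow> complex) \<Rightarrow> nat \<Rightarrow> ('n option + 'n option) cpoly" where
  "alpha_form \<delta> x l = (\<Sum>j\<in>UNIV. cvar (Inl j) * cconst (ceval x ((\<delta> ^^ l) (coord j))))"

definition beta_form ::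
  "('n::finite cpoly \<Rightarrow> 'n cpoly) \<Rightarrow> ('n \<Rightarrow> complex) \<Rightarrow> nat \<Rightarrow> ('n option + 'n option) cpoly" where
  "beta_form \<delta> x l = (\<Sum>j\<in>UNIV. cvar (Inr j) * cconst (ceval x ((\<delta> ^^ l) (coord j))))"

definition f_entry ::
  "('n::finite cpoly \<Rightarrow> 'n cpoly) \<Rightarrow> ('n \<Rightarrow> complex) \<Rightarrow> nat \<Rightarrow> nat \<Rightarrow> ('n option + 'n option) cpoly"
  where
  "f_entry \<delta> x l k = beta_form \<delta> x l * alpha_form \<delta> x k - alpha_form \<delta> x l * beta_form \<delta> x k"

definition F_entry ::
  "('n::finite cpoly \<Rightarrow> 'n cpoly) \<Rightarrow> nat \<Rightarrow> ('n \<Rightarrow> complex) \<Rightarrow> nat \<Rightarrow> nat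
     \<Rightarrow> ('n option + 'n option) cpoly" where
  "F_entry \<delta> d x l k = (\<Sum>r\<in>{0..min (d - l) k}.
     f_entry \<delta> x (l + r) (k - r) *
     of_nat (\<Prod>j<d - l - r. d - j) * of_nat (\<Prod>j<r. k - j))"

text \<open>Matrix indices start at \<open>0\<close>, so row \<open>i\<close> is the row \<open>l = i + 1\<close>.\<close>

definition P_poly ::
  "('n::finite cpoly \<Rightarrow> 'n cpoly) \<Rightarrow> nat \<Rightarrow> ('n \<Rightarrow> complex) \<Rightarrow> ('n option + 'n option) cpoly" where
  "P_poly \<delta> d x = det (mat d d (\<lambda>(i, k). F_entry \<delta> d x (i + 1) k))"

end

theory Submission
  imports
    Defs
    "HOL-Computational_Algebra.Fundamental_Theorem_Algebra"
    "HOL-Computational_Algebra.Field_as_Ring"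
begin

text \<open>In homogeneous coordinates the orbit of \<open>x\<close> is the polynomial curve
  \<open>\<gamma>(t) = (\<Sum>l\<le>d. t\<^sup>l / l! v\<^sub>l)\<close> with \<open>v\<^sub>l = ((\<delta>\<^sup>l x\<^sub>j)(x))\<^sub>j\<close>, and its closure adds the single point
  \<open>[v\<^sub>d]\<close>. The hyperplanes \<open>\<alpha>\<close> and \<open>\<beta>\<close> meet on the closure iff the polynomials \<open>\<alpha> \<cdot> \<gamma>\<close> and
  \<open>\<beta> \<cdot> \<gamma>\<close>, taken as forms of degree \<open>d\<close>, have a common zero on the projective line. Up to the
  nonzero factors \<open>d! k!\<close> the entries \<open>F\<^sub>l\<^sub>k\<close> are those of the Bezout matrix of the two polynomials,
  so \<open>P(x)\<close> vanishes exactly on the Chow hypersurface. Conversely let \<open>Q\<close> be another equation of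
  bidegree \<open>(d, d)\<close>. For generic \<open>\<alpha>\<close> the polynomial \<open>\<alpha> \<cdot> \<gamma>\<close> has \<open>d\<close> simple zeros, so on a generic
  line of \<open>\<beta>\<close>'s both \<open>P\<close> and \<open>Q\<close> have degree at most \<open>d\<close> and \<open>d\<close> common zeros. Hence they are
  proportional as functions of \<open>\<beta>\<close>, likewise as functions of \<open>\<alpha>\<close>, and therefore altogether.\<close>

section \<open>Multivariate polynomials\<close>

lemma poly_mapping_single_add_induct [case_names single add]:
  fixes p :: "'a \<Rightarrow>\<^sub>0 'b::comm_monoid_add"
  assumes single: "\<And>m c. P (Poly_Mapping.single m c)"
    and add: "\<And>p q. P p \<Longrightarrow> P q \<Longrightarrow> P (p + q)"
  shows "P p"
proof (induction p rule: update_induct)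
  case const
  show ?case using single[of undefined 0] by simp
next
  case (update f m c)
  have "Poly_Mapping.update m c f = f + Poly_Mapping.single m c"
    using update(1)
    by (intro poly_mapping_eqI) (auto simp: lookup_update lookup_add lookup_single in_keys_iff)
  then show ?case by (simp add: add update.IH single)
qed

lemma cpoly_induct [case_names const var add mult]:
  fixes p :: "'v cpoly"
  assumes const: "\<And>c. P (cconst c)" and var: "\<And>i. P (cvar i)"
    and add: "\<And>p q. P p \<Longrightarrow> P q \<Longrightarrow> P (p + q)"
    and mult: "\<And>p q. P p \<Longrightarrow> P q \<Longrightarrow> P (p * q)"
  shows "P p"
proof (induction p rule: poly_mapping_single_add_induct)
  case (single m c)
  show ?case
  proof (induction m arbitrary: c rule: poly_mapping_single_add_induct)
    case (single i k)
    show ?case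
    proof (induction k)
      case 0
      show ?case using const[of c] by (simp add: cconst_def)
    next
      case (Suc k)
      have "Poly_Mapping.single (Poly_Mapping.single i (Suc k)) c =
          cvar i * Poly_Mapping.single (Poly_Mapping.single i k) c"
        by (simp add: cvar_def mult_single flip: single_add)
      then show ?case using mult[OF var Suc] by simp
    qed
  next
    case (add m m')
    show ?case
      using mult[OF add.IH(1)[of c] add.IH(2)[of 1]] by (simp add: mult_single)
  qed
qed (rule add)

lemma ceval_superset:
  assumes "finite M" "Poly_Mapping.keys p \<subseteq> M"
  shows "ceval x p =
    (\<Sum>m\<in>M. Poly_Mapping.lookup p m * (\<Prod>i\<in>UNIV. x i ^ Poly_Mapping.lookup m i))"
  unfolding ceval_def using assms
  by (intro sum.mono_neutral_left) (auto simp: in_keys_iff)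

lemma ceval_single:
  "ceval x (Poly_Mapping.single m c) = c * (\<Prod>i\<in>UNIV. x i ^ Poly_Mapping.lookup m i)"
  by (subst ceval_superset[of "{m}"]) auto

lemma ceval_add: "ceval x (p + q) = ceval x p + ceval x q"
proof -
  let ?M = "Poly_Mapping.keys p \<union> Poly_Mapping.keys q"
  have "Poly_Mapping.keys (p + q) \<subseteq> ?M" by (rule keys_add)
  then show ?thesis
    by (simp add: ceval_superset[of ?M] lookup_add sum.distrib algebra_simps)
qed

lemma ceval_mult: "ceval x (p * q) = ceval x p * ceval x q"
proof (induction p rule: poly_mapping_single_add_induct)
  case (single m c)
  show ?case
  proof (induction q rule: poly_mapping_single_add_induct)
    case (single m' c')
    show ?case
      by (simp add: mult_single ceval_single lookup_add power_add prod.distrib algebra_simps)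
  qed (simp add: distrib_left ceval_add)
qed (simp add: distrib_right ceval_add)

lemma ceval_cconst [simp]: "ceval x (cconst c) = c"
  by (simp add: cconst_def ceval_single)

lemma ceval_cvar [simp]: "ceval x (cvar i) = x i"
proof -
  have "(\<Prod>j\<in>UNIV. x j ^ Poly_Mapping.lookup (Poly_Mapping.single i (1::nat)) j) =
      (\<Prod>j\<in>UNIV. if j = i then x j else 1)"
    by (intro prod.cong) (auto simp: lookup_single)
  then show ?thesis by (simp add: cvar_def ceval_single)
qed

lemma cconst_1: "cconst 1 = 1"
  by (simp add: cconst_def)

lemma cconst_mult: "cconst (a * b) = cconst a * cconst b"
  by (simp add: cconst_def mult_single)

lemma cconst_of_nat: "cconst (of_nat n) = of_nat n"
  by (simp add: cconst_def)

interpretation ceval: comm_ring_hom "ceval x"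
  using ceval_cconst[of x 1]
  by unfold_locales (simp_all add: ceval_add ceval_mult cconst_1, simp add: ceval_def)

lemma ring_hom_eq_ceval:
  assumes "comm_ring_hom h" "\<And>c. h (cconst c) = c"
  shows "h p = ceval (\<lambda>i. h (cvar i)) p"
proof -
  interpret h: comm_ring_hom h by fact
  show ?thesis
    by (induction p rule: cpoly_induct)
      (simp_all add: assms(2) h.hom_add h.hom_mult ceval_add ceval_mult)
qed

definition poly_subst :: "('v::finite \<Rightarrow> complex poly) \<Rightarrow> 'v cpoly \<Rightarrow> complex poly" where
  "poly_subst c p = (\<Sum>m\<in>Poly_Mapping.keys p.
     smult (Poly_Mapping.lookup p m) (\<Prod>i\<in>UNIV. c i ^ Poly_Mapping.lookup m i))"

lemma poly_poly_subst: "poly (poly_subst c p) t = ceval (\<lambda>i. poly (c i) t) p"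
  by (simp add: poly_subst_def ceval_def poly_sum poly_prod)

lemma degree_poly_subst_le:
  assumes "\<And>m. m \<in> Poly_Mapping.keys p \<Longrightarrow>
    (\<Sum>i\<in>UNIV. Poly_Mapping.lookup m i * degree (c i)) \<le> k"
  shows "degree (poly_subst c p) \<le> k"
  unfolding poly_subst_def
proof (intro degree_sum_le finite_keys)
  fix m assume m: "m \<in> Poly_Mapping.keys p"
  have "degree (\<Prod>i\<in>UNIV. c i ^ Poly_Mapping.lookup m i) \<le>
      (\<Sum>i\<in>UNIV. degree (c i ^ Poly_Mapping.lookup m i))"
    by (rule order_trans[OF degree_prod_sum_le]) auto
  also have "\<dots> \<le> (\<Sum>i\<in>UNIV. Poly_Mapping.lookup m i * degree (c i))"
    by (intro sum_mono) (metis degree_power_le mult.commute)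
  also have "\<dots> \<le> k" by (rule assms) (rule m)
  finally show "degree (smult (Poly_Mapping.lookup p m)
      (\<Prod>i\<in>UNIV. c i ^ Poly_Mapping.lookup m i)) \<le> k"
    by (rule order_trans[OF degree_smult_le])
qed

text \<open>Weights \<open>N ^ e i\<close> turn an exponent vector into the value at \<open>N\<close> of the polynomial with the
  exponents as coefficients, and distinct polynomials agree at finitely many \<open>N\<close> only.\<close>

lemma ex_separating_weights:
  fixes M :: "('v::finite \<Rightarrow>\<^sub>0 nat) set"
  assumes "finite M"
  obtains w :: "'v \<Rightarrow> nat" where "inj_on (\<lambda>m. \<Sum>i\<in>UNIV. Poly_Mapping.lookup m i * w i) M"
proof -
  obtain e :: "'v \<Rightarrow> nat" where e: "inj e"
    using finite_imp_inj_to_nat_seg[OF finite_UNIV] by blast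
  define q where "q m = (\<Sum>i\<in>UNIV. monom (int (Poly_Mapping.lookup m i)) (e i))"
    for m :: "'v \<Rightarrow>\<^sub>0 nat"
  have coeff_q: "coeff (q m) (e i) = int (Poly_Mapping.lookup m i)" for m i
    using e by (simp add: q_def coeff_sum inj_eq)
  have q_neq: "q m \<noteq> q m'" if "m \<noteq> m'" for m m'
    using that by (metis coeff_q of_nat_eq_iff poly_mapping_eqI)
  have agree: "finite {n. poly (q m) n = poly (q m') n}" if "m \<noteq> m'" for m m'
    using poly_roots_finite[of "q m - q m'"] q_neq[OF that] by simp
  define R where "R = (\<Union>(m, m')\<in>M \<times> M - Id. {n. poly (q m) n = poly (q m') n})"
  have "finite R" unfolding R_def using assms agree by auto
  moreover have "infinite (range int)" by (simp add: finite_image_iff)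
  ultimately obtain N where N: "int N \<notin> R"
    by (meson finite_subset image_subset_iff)
  have poly_q: "poly (q m) (int N) = int (\<Sum>i\<in>UNIV. Poly_Mapping.lookup m i * N ^ e i)" for m
    by (simp add: q_def poly_sum poly_monom)
  have "inj_on (\<lambda>m. \<Sum>i\<in>UNIV. Poly_Mapping.lookup m i * N ^ e i) M"
  proof (rule inj_onI)
    fix m m' assume m: "m \<in> M" "m' \<in> M"
      and "(\<Sum>i\<in>UNIV. Poly_Mapping.lookup m i * N ^ e i) =
        (\<Sum>i\<in>UNIV. Poly_Mapping.lookup m' i * N ^ e i)"
    then have "poly (q m) (int N) = poly (q m') (int N)" by (simp only: poly_q)
    then show "m = m'" using N m by (auto simp: R_def)
  qed
  then show ?thesis by (rule that)
qed

lemma ceval_nonzero_ex: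
  assumes "p \<noteq> 0"
  obtains x where "ceval x p \<noteq> 0"
proof -
  let ?K = "Poly_Mapping.keys p"
  obtain w where w: "inj_on (\<lambda>m. \<Sum>i\<in>UNIV. Poly_Mapping.lookup m i * w i) ?K"
    using ex_separating_weights[OF finite_keys] .
  define weight where "weight m = (\<Sum>i\<in>UNIV. Poly_Mapping.lookup m i * w i)" for m
  define r where "r = (\<Sum>m\<in>?K. monom (Poly_Mapping.lookup p m) (weight m))"
  obtain m where m: "m \<in> ?K"
    using assms by (metis ex_in_conv keys_eq_empty)
  have "coeff r (weight m) = (\<Sum>m'\<in>?K. if m' = m then Poly_Mapping.lookup p m' else 0)"
    unfolding r_def coeff_sum using w m
    by (intro sum.cong) (auto simp: weight_def dest: inj_onD)
  also have "\<dots> \<noteq> 0" using m by (simp add: in_keys_iff)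
  finally have "r \<noteq> 0" by force
  then obtain t where "poly r t \<noteq> 0"
    using poly_all_0_iff_0 by blast
  moreover have "ceval (\<lambda>i. t ^ w i) p = poly r t"
    by (simp add: ceval_def r_def poly_sum poly_monom weight_def power_sum mult.commute
        flip: power_mult)
  ultimately show ?thesis using that by metis
qed

lemma ceval_ext: "(\<And>x. ceval x p = ceval x q) \<Longrightarrow> p = q"
  by (metis ceval.hom_minus ceval_nonzero_ex right_minus_eq)

section \<open>Weighted homogeneous polynomials\<close>

definition homogeneous_wrt :: "(('v \<Rightarrow>\<^sub>0 nat) \<Rightarrow> nat) \<Rightarrow> nat \<Rightarrow> 'v cpoly \<Rightarrow> bool" where
  "homogeneous_wrt w k p \<longleftrightarrow> (\<forall>m\<in>Poly_Mapping.keys p. w m = k)"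

locale additive_weight =
  fixes w :: "('v \<Rightarrow>\<^sub>0 nat) \<Rightarrow> nat"
  assumes weight_add: "w (m + m') = w m + w m'"
begin

lemma homogeneous_zero: "homogeneous_wrt w k 0"
  by (simp add: homogeneous_wrt_def)

lemma homogeneous_add:
  "homogeneous_wrt w k p \<Longrightarrow> homogeneous_wrt w k q \<Longrightarrow> homogeneous_wrt w k (p + q)"
  using keys_add[of p q] by (fastforce simp: homogeneous_wrt_def)

lemma homogeneous_diff:
  "homogeneous_wrt w k p \<Longrightarrow> homogeneous_wrt w k q \<Longrightarrow> homogeneous_wrt w k (p - q)"
  using keys_diff[of p q] by (fastforce simp: homogeneous_wrt_def)

lemma homogeneous_sum:
  "(\<And>i. i \<in> A \<Longrightarrow> homogeneous_wrt w k (f i)) \<Longrightarrow> homogeneous_wrt w k (sum f A)"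
  by (induction A rule: infinite_finite_induct) (auto simp: homogeneous_zero homogeneous_add)

lemma homogeneous_mult:
  "homogeneous_wrt w k p \<Longrightarrow> homogeneous_wrt w l q \<Longrightarrow> homogeneous_wrt w (k + l) (p * q)"
  using keys_mult[of p q] by (fastforce simp: homogeneous_wrt_def weight_add)

lemma homogeneous_cconst: "homogeneous_wrt w 0 (cconst c)"
  using weight_add[of 0 0] by (simp add: homogeneous_wrt_def cconst_def)

lemma homogeneous_of_int: "homogeneous_wrt w 0 (of_int n)"
  using homogeneous_cconst[of "of_int n"] by (simp add: cconst_def)

lemma homogeneous_mult_cconst:
  "homogeneous_wrt w k p \<Longrightarrow> homogeneous_wrt w k (p * cconst c)"
  using homogeneous_mult[OF _ homogeneous_cconst, of k p] by simp

lemma homogeneous_prod: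
  "(\<And>i. i \<in> A \<Longrightarrow> homogeneous_wrt w k (f i)) \<Longrightarrow> homogeneous_wrt w (card A * k) (prod f A)"
proof (induction A rule: infinite_finite_induct)
  case (insert i A)
  then show ?case by (simp add: homogeneous_mult)
qed (use homogeneous_of_int[of 1] in simp_all)

lemma homogeneous_det:
  assumes "\<And>i j. i < n \<Longrightarrow> j < n \<Longrightarrow> homogeneous_wrt w k (f (i, j))"
  shows "homogeneous_wrt w (n * k) (det (mat n n f))"
proof -
  have "homogeneous_wrt w (0 + card {0..<n} * k) (signof p * (\<Prod>i = 0..<n. mat n n f $$ (i, p i)))"
    if "p permutes {0..<n}" for p
  proof (intro homogeneous_mult homogeneous_prod)
    show "homogeneous_wrt w 0 (signof p)"
      using homogeneous_of_int[of "sign p"] by simp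
    fix i assume "i \<in> {0..<n}"
    moreover from this have "p i < n" using permutes_in_image[OF that, of i] by simp
    ultimately show "homogeneous_wrt w k (mat n n f $$ (i, p i))" using assms by simp
  qed
  then show ?thesis
    by (subst det_def'[where n = n]) (auto intro!: homogeneous_sum)
qed

end

definition total_degree :: "('v::finite \<Rightarrow>\<^sub>0 nat) \<Rightarrow> nat" where
  "total_degree m = (\<Sum>i\<in>UNIV. Poly_Mapping.lookup m i)"

definition left_degree :: "('v::finite + 'w::finite \<Rightarrow>\<^sub>0 nat) \<Rightarrow> nat" where
  "left_degree m = (\<Sum>i\<in>UNIV. Poly_Mapping.lookup m (Inl i))"

definition right_degree :: "('v::finite + 'w::finite \<Rightarrow>\<^sub>0 nat) \<Rightarrow> nat" where
  "right_degree m = (\<Sum>i\<in>UNIV. Poly_Mapping.lookup m (Inr i))"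

interpretation total: additive_weight total_degree
  rewrites "homogeneous_wrt total_degree = homogeneous"
proof -
  show "additive_weight (total_degree :: ('a \<Rightarrow>\<^sub>0 nat) \<Rightarrow> nat)"
    by standard (simp add: total_degree_def lookup_add sum.distrib)
qed (simp add: fun_eq_iff homogeneous_def homogeneous_wrt_def total_degree_def)

interpretation left: additive_weight left_degree
  by standard (simp add: left_degree_def lookup_add sum.distrib)

interpretation right: additive_weight right_degree
  by standard (simp add: right_degree_def lookup_add sum.distrib)

lemma bihomogeneous_iff:
  "bihomogeneous k l p \<longleftrightarrow> homogeneous_wrt left_degree k p \<and> homogeneous_wrt right_degree l p"
  by (auto simp: bihomogeneous_def homogeneous_wrt_def left_degree_def right_degree_def)

lemma ceval_homogeneous_scale:
  assumes "homogeneous k p"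
  shows "ceval (\<lambda>i. c * v i) p = c ^ k * ceval v p"
  unfolding ceval_def sum_distrib_left using assms
  by (intro sum.cong)
    (auto simp: power_mult_distrib prod.distrib homogeneous_def simp flip: power_sum)

lemma prod_UNIV_sum:
  "(\<Prod>i\<in>(UNIV :: ('a::finite + 'b::finite) set). f i) =
    (\<Prod>i\<in>UNIV. f (Inl i)) * (\<Prod>i\<in>UNIV. f (Inr i))"
  using prod.Plus[of "UNIV :: 'a set" "UNIV :: 'b set" f] by (simp add: UNIV_Plus_UNIV comp_def)

lemma ceval_bihomogeneous_scale:
  assumes "bihomogeneous k l p"
  shows "ceval (case_sum (\<lambda>i. c * a i) (\<lambda>i. c' * b i)) p = c ^ k * c' ^ l * ceval (case_sum a b) p"
  unfolding ceval_def sum_distrib_left using assms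
  by (intro sum.cong)
    (auto simp: prod_UNIV_sum power_mult_distrib prod.distrib bihomogeneous_def
      simp flip: power_sum)

section \<open>Functions that are polynomial along lines\<close>

definition poly_on_lines :: "(('v \<Rightarrow> 'a) \<Rightarrow> 'a::comm_ring_1) \<Rightarrow> bool" where
  "poly_on_lines f \<longleftrightarrow> (\<forall>a b. \<exists>r. \<forall>s. f (\<lambda>i. a i + s * b i) = poly r s)"

definition degree_on_lines_le :: "nat \<Rightarrow> (('v \<Rightarrow> 'a) \<Rightarrow> 'a::comm_ring_1) \<Rightarrow> bool" where
  "degree_on_lines_le k f \<longleftrightarrow>
     (\<forall>a b. \<exists>r. degree r \<le> k \<and> (\<forall>s. f (\<lambda>i. a i + s * b i) = poly r s))"

lemma degree_on_lines_le_imp_poly_on_lines: "degree_on_lines_le k f \<Longrightarrow> poly_on_lines f"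
  unfolding degree_on_lines_le_def poly_on_lines_def by blast

lemma poly_on_linesE:
  assumes "poly_on_lines f"
  obtains r where "\<And>s. f (\<lambda>i. a i + s * b i) = poly r s"
  using assms unfolding poly_on_lines_def by blast

lemma poly_on_lines_const: "poly_on_lines (\<lambda>_. c)"
  unfolding poly_on_lines_def by (auto intro!: exI[of _ "[:c:]"])

lemma poly_on_lines_combine:
  assumes "poly_on_lines f" "poly_on_lines g"
    and h: "\<And>p q s. h (poly p s) (poly q s) = poly (H p q) s"
  shows "poly_on_lines (\<lambda>x. h (f x) (g x))"
  unfolding poly_on_lines_def
proof (intro allI)
  fix a b
  obtain p where p: "\<And>s. f (\<lambda>i. a i + s * b i) = poly p s"
    using poly_on_linesE[OF assms(1), of a b] by blast
  obtain q where q: "\<And>s. g (\<lambda>i. a i + s * b i) = poly q s"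
    using poly_on_linesE[OF assms(2), of a b] by blast
  show "\<exists>r. \<forall>s. h (f (\<lambda>i. a i + s * b i)) (g (\<lambda>i. a i + s * b i)) = poly r s"
    by (intro exI[of _ "H p q"]) (simp add: p q h)
qed

lemma poly_on_lines_diff:
  "poly_on_lines f \<Longrightarrow> poly_on_lines g \<Longrightarrow> poly_on_lines (\<lambda>x. f x - g x)"
  by (rule poly_on_lines_combine[where h = "(-)" and H = "(-)"]) simp_all

lemma poly_on_lines_mult:
  "poly_on_lines f \<Longrightarrow> poly_on_lines g \<Longrightarrow> poly_on_lines (\<lambda>x. f x * g x)"
  by (rule poly_on_lines_combine[where h = "(*)" and H = "(*)"]) simp_all

lemma poly_on_lines_prod:
  "(\<And>i. i \<in> I \<Longrightarrow> poly_on_lines (f i)) \<Longrightarrow> poly_on_lines (\<lambda>x. \<Prod>i\<in>I. f i x)"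
  by (induction I rule: infinite_finite_induct) (auto simp: poly_on_lines_const poly_on_lines_mult)

lemma poly_on_lines_mult_nonzero_ex:
  fixes f g :: "('v \<Rightarrow> 'a) \<Rightarrow> 'a::{idom, ring_char_0}"
  assumes "poly_on_lines f" "poly_on_lines g" "f a \<noteq> 0" "g b \<noteq> 0"
  shows "\<exists>x. f x * g x \<noteq> 0"
proof -
  let ?line = "\<lambda>s i. a i + s * (b i - a i)"
  obtain r where r: "\<And>s. f (?line s) = poly r s"
    using poly_on_linesE[OF assms(1), of a "\<lambda>i. b i - a i"] by blast
  obtain r' where r': "\<And>s. g (?line s) = poly r' s"
    using poly_on_linesE[OF assms(2), of a "\<lambda>i. b i - a i"] by blast
  have "r \<noteq> 0" using r[of 0] assms(3) by auto
  moreover have "r' \<noteq> 0" using r'[of 1] assms(4) by auto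
  ultimately have "r * r' \<noteq> 0" by simp
  then obtain s where "poly (r * r') s \<noteq> 0" using poly_all_0_iff_0 by blast
  then show ?thesis by (intro exI[of _ "?line s"]) (simp add: r r')
qed

lemma poly_on_lines_prod_nonzero_ex:
  fixes f :: "'i \<Rightarrow> ('v \<Rightarrow> 'a) \<Rightarrow> 'a::{idom, ring_char_0}"
  assumes "finite I" "\<And>i. i \<in> I \<Longrightarrow> poly_on_lines (f i)" "\<And>i. i \<in> I \<Longrightarrow> \<exists>x. f i x \<noteq> 0"
  shows "\<exists>x. (\<Prod>i\<in>I. f i x) \<noteq> 0"
  using assms
proof (induction I rule: finite_induct)
  case (insert i I)
  obtain a where "f i a \<noteq> 0" using insert.prems(2) by blast
  moreover obtain b where "(\<Prod>j\<in>I. f j b) \<noteq> 0" using insert.IH insert.prems by blast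
  ultimately have "\<exists>x. f i x * (\<Prod>j\<in>I. f j x) \<noteq> 0"
    using insert.prems(1) by (intro poly_on_lines_mult_nonzero_ex poly_on_lines_prod) auto
  then show ?case using insert.hyps by simp
qed simp

lemma poly_on_lines_eq_0:
  fixes f g :: "('v \<Rightarrow> 'a) \<Rightarrow> 'a::{idom, ring_char_0}"
  assumes "poly_on_lines f" "poly_on_lines g" "g b \<noteq> 0" "\<And>x. g x \<noteq> 0 \<Longrightarrow> f x = 0"
  shows "f x = 0"
proof (rule ccontr)
  assume "f x \<noteq> 0"
  then obtain y where "f y * g y \<noteq> 0"
    using poly_on_lines_mult_nonzero_ex[of f g x b] assms(1-3) by blast
  then show False using assms(4)[of y] by simp
qed

lemma poly_on_lines_ceval: "poly_on_lines (\<lambda>x. ceval x p)"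
  unfolding poly_on_lines_def
proof (intro allI)
  fix a b
  have "ceval (\<lambda>i. a i + s * b i) p = poly (poly_subst (\<lambda>i. [:a i, b i:]) p) s" for s
    by (simp add: poly_poly_subst)
  then show "\<exists>r. \<forall>s. ceval (\<lambda>i. a i + s * b i) p = poly r s" by blast
qed

lemma degree_on_lines_le_ceval:
  fixes F :: "('w::finite \<Rightarrow> complex) \<Rightarrow> 'v::finite \<Rightarrow> complex"
  assumes "inj \<iota>" and range: "\<And>a j. F a (\<iota> j) = a j"
    and off_range: "\<And>a b i. i \<notin> range \<iota> \<Longrightarrow> F a i = F b i"
    and partial_degree: "\<And>m. m \<in> Poly_Mapping.keys p \<Longrightarrow> (\<Sum>j\<in>UNIV. Poly_Mapping.lookup m (\<iota> j)) \<le> k"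
  shows "degree_on_lines_le k (\<lambda>a. ceval (F a) p)"
  unfolding degree_on_lines_le_def
proof (intro allI)
  fix a b
  let ?line = "\<lambda>i. [:F a i, if i \<in> range \<iota> then F b i else 0:]"
  have "degree (poly_subst ?line p) \<le> k"
  proof (rule degree_poly_subst_le)
    fix m assume m: "m \<in> Poly_Mapping.keys p"
    have "(\<Sum>i\<in>UNIV. Poly_Mapping.lookup m i * degree (?line i)) \<le>
        (\<Sum>i\<in>UNIV. if i \<in> range \<iota> then Poly_Mapping.lookup m i else 0)"
      by (intro sum_mono) auto
    also have "\<dots> = (\<Sum>j\<in>UNIV. Poly_Mapping.lookup m (\<iota> j))"
      using \<open>inj \<iota>\<close> by (simp add: sum.If_cases sum.reindex)
    finally show "(\<Sum>i\<in>UNIV. Poly_Mapping.lookup m i * degree (?line i)) \<le> k"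
      using partial_degree[OF m] by linarith
  qed
  moreover have "F (\<lambda>i. a i + s * b i) i = poly (?line i) s" for s i
    using off_range[of i] by (cases "i \<in> range \<iota>") (auto simp: range)
  then have "ceval (F (\<lambda>i. a i + s * b i)) p = poly (poly_subst ?line p) s" for s
    unfolding poly_poly_subst by presburger
  ultimately show "\<exists>r. degree r \<le> k \<and> (\<forall>s. ceval (F (\<lambda>i. a i + s * b i)) p = poly r s)"
    by blast
qed

lemma degree_on_lines_le_ceval_left:
  "bihomogeneous k l p \<Longrightarrow> degree_on_lines_le k (\<lambda>a. ceval (case_sum a b) p)"
  by (rule degree_on_lines_le_ceval[where \<iota> = Inl])
    (auto simp: bihomogeneous_def split: sum.split)

lemma degree_on_lines_le_ceval_right:
  "bihomogeneous k l p \<Longrightarrow> degree_on_lines_le l (\<lambda>b. ceval (case_sum a b) p)"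
  by (rule degree_on_lines_le_ceval[where \<iota> = Inr])
    (auto simp: bihomogeneous_def split: sum.split)

lemma poly_proportional:
  fixes p q :: "'a::idom poly"
  assumes "finite S" "degree p \<le> card S" "degree q \<le> card S"
    and "\<And>s. s \<in> S \<Longrightarrow> poly p s = 0" "\<And>s. s \<in> S \<Longrightarrow> poly q s = 0"
  shows "poly p s * poly q s' = poly q s * poly p s'"
proof (cases "s' \<in> S")
  case False
  have "smult (poly q s') p = smult (poly p s') q"
  proof (rule poly_eqI_degree)
    show "poly (smult (poly q s') p) z = poly (smult (poly p s') q) z" if "z \<in> insert s' S" for z
      using that assms(4,5) by auto
    show "degree (smult (poly q s') p) < card (insert s' S)"
      "degree (smult (poly p s') q) < card (insert s' S)"
      using False assms(1-3) by (simp_all add: le_imp_less_Suc)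
  qed
  then have "poly (smult (poly q s') p) s = poly (smult (poly p s') q) s" by simp
  then show ?thesis by (simp add: mult.commute)
qed (simp add: assms)

section \<open>Linear forms\<close>

definition dotp :: "('v::finite \<Rightarrow> 'a) \<Rightarrow> ('v \<Rightarrow> 'a) \<Rightarrow> 'a::comm_ring_1" where
  "dotp a v = (\<Sum>j\<in>UNIV. a j * v j)"

definition coord_form :: "'v \<Rightarrow> 'v \<Rightarrow> 'a::comm_ring_1" where
  "coord_form j i = of_bool (i = j)"

lemma dotp_coord_form [simp]: "dotp (coord_form j) v = v j"
  by (simp add: dotp_def coord_form_def of_bool_def if_distrib[of "\<lambda>x. x * _"] cong: if_cong)

lemma dotp_scale_left: "dotp (\<lambda>i. c * a i) v = c * dotp a v"
  by (simp add: dotp_def sum_distrib_left mult.assoc)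

lemma dotp_scale_right: "dotp a (\<lambda>i. c * v i) = c * dotp a v"
  by (simp add: dotp_def sum_distrib_left algebra_simps)

lemma dotp_add_left: "dotp (\<lambda>i. a i + b i) v = dotp a v + dotp b v"
  by (simp add: dotp_def sum.distrib algebra_simps)

lemma dotp_diff_left: "dotp (\<lambda>i. a i - b i) v = dotp a v - dotp b v"
  by (simp add: dotp_def sum_subtractf algebra_simps)

lemma dotp_diff_right: "dotp a (\<lambda>i. v i - w i) = dotp a v - dotp a w"
  by (simp add: dotp_def sum_subtractf algebra_simps)

lemma poly_on_lines_dotp: "poly_on_lines (\<lambda>a. dotp a v)"
  unfolding poly_on_lines_def dotp_add_left dotp_scale_left
  by (intro allI exI[of _ "[:dotp _ v, dotp _ v:]"]) simp

lemma ex_dotp_nonzero: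
  fixes Z :: "('v::finite \<Rightarrow> 'a::{idom, ring_char_0}) set"
  assumes "finite Z" "(\<lambda>_. 0) \<notin> Z"
  obtains a where "\<And>z. z \<in> Z \<Longrightarrow> dotp a z \<noteq> 0"
proof -
  have "\<exists>a. dotp a z \<noteq> 0" if "z \<in> Z" for z
  proof -
    have "z \<noteq> (\<lambda>_. 0)" using that assms(2) by blast
    then obtain j where "z j \<noteq> 0" by (auto simp: fun_eq_iff)
    then show ?thesis by (intro exI[of _ "coord_form j"]) simp
  qed
  then obtain a where "(\<Prod>z\<in>Z. dotp a z) \<noteq> 0"
    using poly_on_lines_prod_nonzero_ex[of Z "\<lambda>z a. dotp a z"] assms(1) poly_on_lines_dotp by blast
  then show ?thesis using that assms(1) by auto
qed

lemma proportional_along_separating_line: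
  fixes U :: "('v::finite \<Rightarrow> 'a::field) set"
  assumes U: "finite U" "\<And>u. u \<in> U \<Longrightarrow> dotp e u = 1"
    and f: "degree_on_lines_le (card U) f" "\<And>u b. u \<in> U \<Longrightarrow> dotp b u = 0 \<Longrightarrow> f b = 0"
    and g: "degree_on_lines_le (card U) g" "\<And>u b. u \<in> U \<Longrightarrow> dotp b u = 0 \<Longrightarrow> g b = 0"
    and separating: "\<And>u. u \<in> U \<Longrightarrow> dotp c u \<noteq> 0" "inj_on (dotp c) U"
  shows "f (\<lambda>i. e i + c i) * g e = g (\<lambda>i. e i + c i) * f e"
proof -
  define root where "root u = - 1 / dotp c u" for u
  have "inj_on root U" using separating by (auto simp: root_def inj_on_def)
  then have card: "card (root ` U) = card U" by (rule card_image)
  have zero: "dotp (\<lambda>i. e i + root u * c i) u = 0" if "u \<in> U" for u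
    unfolding dotp_add_left dotp_scale_left using separating(1) U(2) that by (simp add: root_def)
  obtain p where p: "degree p \<le> card U" "\<And>s. f (\<lambda>i. e i + s * c i) = poly p s"
    using f(1) unfolding degree_on_lines_le_def by metis
  obtain q where q: "degree q \<le> card U" "\<And>s. g (\<lambda>i. e i + s * c i) = poly q s"
    using g(1) unfolding degree_on_lines_le_def by metis
  have "poly p 1 * poly q 0 = poly q 1 * poly p 0"
    using p(1) q(1) U(1) zero f(2) g(2)
    by (intro poly_proportional[of "root ` U"]) (auto simp: card simp flip: p(2) q(2))
  then show ?thesis by (simp flip: p(2) q(2))
qed

lemma proportional_if_vanishing_on_hyperplanes:
  fixes U :: "('v::finite \<Rightarrow> 'a::field_char_0) set"
  assumes U: "finite U" "\<And>u. u \<in> U \<Longrightarrow> dotp e u = 1"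
    and f: "degree_on_lines_le (card U) f" "\<And>u b. u \<in> U \<Longrightarrow> dotp b u = 0 \<Longrightarrow> f b = 0"
    and g: "degree_on_lines_le (card U) g" "\<And>u b. u \<in> U \<Longrightarrow> dotp b u = 0 \<Longrightarrow> g b = 0"
  shows "f b * g e = g b * f e"
proof -
  define W where "W = U \<union> (\<lambda>(u, u') i. u i - u' i) ` (U \<times> U - Id)"
  define generic where "generic b = (\<Prod>w\<in>W. dotp (\<lambda>i. b i - e i) w)" for b
  have "(\<lambda>_. 0) \<notin> U" using U(2)[of "\<lambda>_. 0"] by (auto simp: dotp_def)
  then have W: "finite W" "(\<lambda>_. 0) \<notin> W"
    using U(1) by (auto simp: W_def fun_eq_iff)
  then obtain c where nonzero_on_W: "\<And>w. w \<in> W \<Longrightarrow> dotp c w \<noteq> 0" using ex_dotp_nonzero by blast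
  have "f b * g e - g b * f e = 0"
  proof (rule poly_on_lines_eq_0[where f = "\<lambda>b. f b * g e - g b * f e" and g = generic])
    show "poly_on_lines (\<lambda>b. f b * g e - g b * f e)"
      using f(1)[THEN degree_on_lines_le_imp_poly_on_lines]
        g(1)[THEN degree_on_lines_le_imp_poly_on_lines]
      by (intro poly_on_lines_diff poly_on_lines_mult poly_on_lines_const)
    show "poly_on_lines generic"
      unfolding generic_def dotp_diff_left
      by (intro poly_on_lines_prod poly_on_lines_diff poly_on_lines_dotp poly_on_lines_const)
    show "generic (\<lambda>i. c i + e i) \<noteq> 0" using nonzero_on_W W(1) by (simp add: generic_def)
  next
    fix b assume "generic b \<noteq> 0"
    then have nonzero: "dotp (\<lambda>i. b i - e i) w \<noteq> 0" if "w \<in> W" for w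
      using that W(1) by (simp add: generic_def)
    have "inj_on (dotp (\<lambda>i. b i - e i)) U"
    proof (rule inj_onI, rule ccontr)
      fix u u' assume u: "u \<in> U" "u' \<in> U" "u \<noteq> u'"
        and eq: "dotp (\<lambda>i. b i - e i) u = dotp (\<lambda>i. b i - e i) u'"
      have "(\<lambda>(u, u') i. u i - u' i) (u, u') \<in> W"
        using u unfolding W_def by blast
      then show False using nonzero[of "\<lambda>i. u i - u' i"] eq by (simp add: dotp_diff_right)
    qed
    then show "f b * g e - g b * f e = 0"
      using proportional_along_separating_line[OF U f g, where c = "\<lambda>i. b i - e i"] nonzero
      by (simp add: W_def)
  qed
  then show ?thesis by simp
qed

definition lin_form :: "('w::finite \<Rightarrow> 'v) \<Rightarrow> ('w \<Rightarrow> complex) \<Rightarrow> 'v cpoly" where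
  "lin_form f v = (\<Sum>j\<in>UNIV. cvar (f j) * cconst (v j))"

lemma ceval_lin_form: "ceval x (lin_form f v) = dotp (x \<circ> f) v"
  by (simp add: lin_form_def dotp_def ceval.hom_sum ceval_mult)

lemma homogeneous_wrt_cvar: "w (Poly_Mapping.single i 1) = k \<Longrightarrow> homogeneous_wrt w k (cvar i)"
  by (simp add: homogeneous_wrt_def cvar_def)

lemma (in additive_weight) homogeneous_lin_form:
  assumes "\<And>j. w (Poly_Mapping.single (f j) 1) = k"
  shows "homogeneous_wrt w k (lin_form f v)"
  unfolding lin_form_def
  by (intro homogeneous_sum homogeneous_mult_cconst homogeneous_wrt_cvar assms)

lemma homogeneous_cvar: "homogeneous 1 (cvar i)"
  by (simp add: homogeneous_def cvar_def lookup_single when_def)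

lemma homogeneous_lin_form_id: "homogeneous 1 (lin_form id v)"
  by (rule total.homogeneous_lin_form) (simp add: total_degree_def lookup_single when_def)

section \<open>The Bezout determinant\<close>

definition bezout_entry ::
  "nat \<Rightarrow> (nat \<Rightarrow> 'a) \<Rightarrow> (nat \<Rightarrow> 'a) \<Rightarrow> nat \<Rightarrow> nat \<Rightarrow> 'a::comm_ring_1" where
  "bezout_entry d a b l k =
     (\<Sum>r\<in>{0..min (d - l) k}. b (l + r) * a (k - r) - a (l + r) * b (k - r))"

definition bezout_det :: "nat \<Rightarrow> (nat \<Rightarrow> 'a) \<Rightarrow> (nat \<Rightarrow> 'a) \<Rightarrow> 'a::comm_ring_1" where
  "bezout_det d a b = det (mat d d (\<lambda>(i, k). bezout_entry d a b (i + 1) k))"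

lemma (in comm_ring_hom) hom_bezout_det:
  "hom (bezout_det d a b) = bezout_det d (\<lambda>l. hom (a l)) (\<lambda>l. hom (b l))"
proof -
  have "map_mat hom (mat d d (\<lambda>(i, k). bezout_entry d a b (i + 1) k)) =
      mat d d (\<lambda>(i, k). bezout_entry d (\<lambda>l. hom (a l)) (\<lambda>l. hom (b l)) (i + 1) k)"
    by (rule eq_matI) (auto simp: bezout_entry_def hom_distribs)
  then show ?thesis by (simp add: bezout_det_def flip: hom_det)
qed

lemma (in additive_weight) homogeneous_bezout_det:
  assumes a: "\<And>l. homogeneous_wrt w i (a l)" and b: "\<And>l. homogeneous_wrt w j (b l)"
  shows "homogeneous_wrt w (d * (i + j)) (bezout_det d a b)"
  unfolding bezout_det_def
proof (rule homogeneous_det)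
  fix p q
  have "homogeneous_wrt w (i + j) (b l * a k - a l * b k)" for l k
    using homogeneous_mult[OF b[of l] a[of k]] homogeneous_mult[OF a[of l] b[of k]]
    by (simp add: homogeneous_diff add.commute)
  then show "homogeneous_wrt w (i + j) (case (p, q) of (i, k) \<Rightarrow> bezout_entry d a b (i + 1) k)"
    unfolding bezout_entry_def split_conv by (intro homogeneous_sum)
qed

lemma bezout_det_swap: "bezout_det d a b = (-1) ^ d * bezout_det d b a"
proof -
  have "mat d d (\<lambda>(i, k). bezout_entry d a b (i + 1) k) =
      (-1) \<cdot>\<^sub>m mat d d (\<lambda>(i, k). bezout_entry d b a (i + 1) k)"
    by (rule eq_matI) (auto simp: bezout_entry_def mult.commute simp flip: sum_negf)
  then show ?thesis by (simp add: bezout_det_def)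
qed

subsection \<open>Relation to the matrix \<open>F\<close>\<close>

lemma prod_diff_mult_fact: "m \<le> n \<Longrightarrow> (\<Prod>j<m. n - j) * fact (n - m) = (fact n :: nat)"
proof (induction m)
  case (Suc m)
  have "fact (n - m) = (n - m) * (fact (n - Suc m) :: nat)"
    using Suc.prems by (simp add: fact_reduce)
  then show ?case using Suc by (simp add: mult.assoc)
qed simp

lemma falling_sum_eq_bezout_entry:
  fixes a b :: "nat \<Rightarrow> 'a::comm_ring_1"
  assumes "l \<le> d"
  defines "A \<equiv> \<lambda>m. of_nat (fact m) * a m" and "B \<equiv> \<lambda>m. of_nat (fact m) * b m"
  shows "(\<Sum>r\<in>{0..min (d - l) k}. (B (l + r) * A (k - r) - A (l + r) * B (k - r)) *
      of_nat (\<Prod>j<d - l - r. d - j) * of_nat (\<Prod>j<r. k - j)) =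
    of_nat (fact d * fact k) * bezout_entry d a b l k"
  unfolding bezout_entry_def sum_distrib_left
proof (rule sum.cong)
  fix r assume r: "r \<in> {0..min (d - l) k}"
  then have "d - (d - l - r) = l + r" using assms(1) by auto
  then have fact_d: "fact d = (\<Prod>j<d - l - r. d - j) * (fact (l + r) :: nat)"
    using prod_diff_mult_fact[of "d - l - r" d] by simp
  have fact_k: "fact k = (\<Prod>j<r. k - j) * (fact (k - r) :: nat)"
    using prod_diff_mult_fact[of r k] r by simp
  show "(B (l + r) * A (k - r) - A (l + r) * B (k - r)) *
      of_nat (\<Prod>j<d - l - r. d - j) * of_nat (\<Prod>j<r. k - j) =
    of_nat (fact d * fact k) * (b (l + r) * a (k - r) - a (l + r) * b (k - r))"
    unfolding fact_d fact_k A_def B_def of_nat_mult by (simp add: algebra_simps del: of_nat_prod)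
qed simp

lemma det_scale_columns:
  "det (mat n n (\<lambda>(i, k). s k * f i k)) = (\<Prod>k<n. s k) * det (mat n n (\<lambda>(i, k). f i k))"
proof -
  let ?A = "mat n n (\<lambda>(i, k). f i k)"
  have "det (mat_diag n s) = prod_list (diag_mat (mat_diag n s))"
    by (rule det_upper_triangular[where n = n]) (auto simp: mat_diag_def upper_triangular_def)
  also have "diag_mat (mat_diag n s) = map s [0..<n]"
    by (simp add: diag_mat_def mat_diag_def)
  also have "prod_list \<dots> = (\<Prod>k<n. s k)"
    by (simp add: atLeast0LessThan flip: prod.distinct_set_conv_list)
  finally have "det (?A * mat_diag n s) = det ?A * (\<Prod>k<n. s k)"
    by (subst det_mult[where n = n]) auto
  moreover have "mat n n (\<lambda>(i, k). s k * f i k) = ?A * mat_diag n s"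
    by (subst mat_diag_mult_right[of _ n]) (auto simp: mult.commute)
  ultimately show ?thesis by (simp add: mult.commute)
qed

subsection \<open>Vanishing\<close>

lemma det_mat_eq_0_iff_kernel:
  fixes f :: "nat \<times> nat \<Rightarrow> 'a::idom"
  shows "det (mat n n f) = 0 \<longleftrightarrow>
    (\<exists>u. (\<exists>k<n. u k \<noteq> 0) \<and> (\<forall>i<n. (\<Sum>k<n. f (i, k) * u k) = 0))" (is "?lhs \<longleftrightarrow> ?rhs")
proof -
  have "?lhs \<longleftrightarrow> (\<exists>v. v \<in> carrier_vec n \<and> v \<noteq> 0\<^sub>v n \<and> mat n n f *\<^sub>v v = 0\<^sub>v n)"
    by (rule det_0_iff_vec_prod_zero) simp
  also have "\<dots> \<longleftrightarrow> ?rhs"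
  proof
    assume "\<exists>v. v \<in> carrier_vec n \<and> v \<noteq> 0\<^sub>v n \<and> mat n n f *\<^sub>v v = 0\<^sub>v n"
    then obtain v where v: "v \<in> carrier_vec n" "v \<noteq> 0\<^sub>v n" "mat n n f *\<^sub>v v = 0\<^sub>v n" by blast
    have "(\<Sum>k<n. f (i, k) * v $ k) = 0" if "i < n" for i
      using arg_cong[OF v(3), of "\<lambda>u. u $ i"] that v(1)
      by (simp add: scalar_prod_def atLeast0LessThan)
    moreover have "\<exists>k<n. v $ k \<noteq> 0"
      using v(1,2) by (metis carrier_vecD eq_vecI index_zero_vec)
    ultimately show ?rhs by blast
  next
    assume ?rhs
    then obtain u where u: "\<exists>k<n. u k \<noteq> 0" "\<And>i. i < n \<Longrightarrow> (\<Sum>k<n. f (i, k) * u k) = 0" by blast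
    have "vec n u \<noteq> 0\<^sub>v n" using u(1) by (metis index_vec index_zero_vec(1))
    moreover have "mat n n f *\<^sub>v vec n u = 0\<^sub>v n"
      using u(2) by (intro eq_vecI) (auto simp: scalar_prod_def atLeast0LessThan)
    ultimately show "\<exists>v. v \<in> carrier_vec n \<and> v \<noteq> 0\<^sub>v n \<and> mat n n f *\<^sub>v v = 0\<^sub>v n"
      by (intro exI[of _ "vec n u"]) simp
  qed
  finally show ?thesis .
qed

lemma det_mat_eq_0_iff_rows_dependent:
  fixes f :: "nat \<times> nat \<Rightarrow> 'a::idom"
  shows "det (mat n n f) = 0 \<longleftrightarrow>
    (\<exists>w. (\<exists>i<n. w i \<noteq> 0) \<and> (\<forall>k<n. (\<Sum>i<n. w i * f (i, k)) = 0))"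
proof -
  have "(mat n n f)\<^sup>T = mat n n (\<lambda>(i, k). f (k, i))" by (rule eq_matI) auto
  then have "det (mat n n f) = det (mat n n (\<lambda>(i, k). f (k, i)))"
    using det_transpose[of "mat n n f" n] by simp
  then show ?thesis by (simp add: det_mat_eq_0_iff_kernel mult.commute)
qed

definition bezout_row :: "'a::comm_ring_1 poly \<Rightarrow> 'a poly \<Rightarrow> nat \<Rightarrow> 'a poly" where
  "bezout_row p q l = poly_shift l q * p - poly_shift l p * q"

lemma bezout_entry_eq_coeff:
  assumes "degree p \<le> d" "degree q \<le> d"
  shows "bezout_entry d (coeff p) (coeff q) l k = coeff (bezout_row p q l) k"
proof -
  have "coeff (poly_shift l p * q) k = (\<Sum>r\<in>{0..min (d - l) k}. coeff p (l + r) * coeff q (k - r))"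
    if "degree p \<le> d" for p q :: "'a poly"
    unfolding coeff_mult coeff_poly_shift using that
    by (intro sum.mono_neutral_cong_right) (auto simp: add.commute coeff_eq_0)
  then show ?thesis
    using assms by (simp add: bezout_row_def bezout_entry_def sum_subtractf)
qed

text \<open>The top terms of the two products cancel: only the parts of degree below \<open>l\<close> of the
  second factors contribute.\<close>

lemma degree_bezout_row_less:
  assumes "0 < l" "l \<le> d" "degree p \<le> d" "degree q \<le> d"
  shows "degree (bezout_row p q l) < d"
proof -
  have split: "p = poly_cutoff l p + monom 1 l * poly_shift l p" for p :: "'a poly"
    by (rule poly_eqI) (auto simp: coeff_poly_cutoff coeff_monom_mult coeff_poly_shift not_less)
  have "bezout_row p q l = poly_shift l q * (poly_cutoff l p + monom 1 l * poly_shift l p)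
      - poly_shift l p * (poly_cutoff l q + monom 1 l * poly_shift l q)"
    by (simp add: bezout_row_def flip: split)
  then have row:
    "bezout_row p q l = poly_shift l q * poly_cutoff l p - poly_shift l p * poly_cutoff l q"
    by (simp add: algebra_simps)
  have "degree (poly_shift l p * poly_cutoff l q) < d" if "degree p \<le> d" for p q :: "'a poly"
  proof -
    have "degree (poly_shift l p) \<le> d - l"
      using that assms(2) by (intro degree_le) (auto simp: coeff_poly_shift coeff_eq_0)
    moreover have "degree (poly_cutoff l q) \<le> l - 1"
      using assms(1) by (intro degree_le) (auto simp: coeff_poly_cutoff)
    ultimately show ?thesis
      using degree_mult_le[of "poly_shift l p" "poly_cutoff l q"] assms(1,2) by linarith
  qed
  then show ?thesis unfolding row using assms by (intro degree_diff_less)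
qed

lemma bezout_det_eq_0_iff_rows_dependent:
  fixes p q :: "'a::idom poly"
  assumes "degree p \<le> d" "degree q \<le> d"
  shows "bezout_det d (coeff p) (coeff q) = 0 \<longleftrightarrow>
    (\<exists>w. (\<exists>i<d. w i \<noteq> 0) \<and> (\<Sum>i<d. smult (w i) (bezout_row p q (i + 1))) = 0)"
proof -
  have "(\<forall>k<d. (\<Sum>i<d. w i * coeff (bezout_row p q (i + 1)) k) = 0) \<longleftrightarrow>
      (\<Sum>i<d. smult (w i) (bezout_row p q (i + 1))) = 0" for w
  proof -
    have "coeff (bezout_row p q (i + 1)) k = 0" if "i < d" "d \<le> k" for i k
      using degree_bezout_row_less[of "i + 1" d p q] that assms by (intro coeff_eq_0) simp
    then have "(\<Sum>i<d. w i * coeff (bezout_row p q (i + 1)) k) = 0" if "d \<le> k" for k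
      using that by simp
    then show ?thesis by (auto simp: poly_eq_iff coeff_sum) (metis not_le)
  qed
  then show ?thesis
    by (simp add: bezout_det_def det_mat_eq_0_iff_rows_dependent bezout_entry_eq_coeff[OF assms])
qed

lemma poly_shifts_independent:
  fixes p :: "'a::idom poly"
  assumes "degree p \<le> d" "coeff p d \<noteq> 0" "(\<Sum>i<d. smult (w i) (poly_shift (i + 1) p)) = 0"
  shows "i < d \<Longrightarrow> w i = 0"
proof (induction i rule: less_induct)
  case (less i)
  have "w j * coeff p (d - (i + 1) + (j + 1)) = (if j = i then w i * coeff p d else 0)"
    if "j < d" for j
  proof -
    consider "j < i" | "j = i" | "j > i" by linarith
    then show ?thesis
      using less that assms(1) by cases (auto intro!: coeff_eq_0)
  qed
  then have "coeff (\<Sum>i<d. smult (w i) (poly_shift (i + 1) p)) (d - (i + 1)) =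
      (\<Sum>j<d. if j = i then w i * coeff p d else 0)"
    by (simp add: coeff_sum coeff_poly_shift)
  then show ?case using assms(2,3) less.prems by simp
qed

lemma bezout_det_nonzero:
  fixes p q :: "'a::field_gcd poly"
  assumes p: "degree p \<le> d" "coeff p d \<noteq> 0" and q: "degree q \<le> d" and "coprime p q"
  shows "bezout_det d (coeff p) (coeff q) \<noteq> 0"
proof
  assume "bezout_det d (coeff p) (coeff q) = 0"
  then obtain w where w: "\<exists>i<d. w i \<noteq> 0" "(\<Sum>i<d. smult (w i) (bezout_row p q (i + 1))) = 0"
    unfolding bezout_det_eq_0_iff_rows_dependent[OF p(1) q] by blast
  define comb where "comb r = (\<Sum>i<d. smult (w i) (poly_shift (i + 1) r))" for r
  have "comb q * p - comb p * q = (\<Sum>i<d. smult (w i) (bezout_row p q (i + 1)))"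
    by (simp add: comb_def bezout_row_def sum_distrib_right smult_diff_right sum_subtractf)
  then have "p dvd comb p * q"
    using w(2) by (metis dvd_triv_right right_minus_eq)
  then have dvd: "p dvd comb p"
    using \<open>coprime p q\<close> by (simp add: coprime_dvd_mult_left_iff)
  have "degree p = d" using p by (simp add: le_antisym le_degree)
  moreover have "degree (comb p) < d"
    unfolding comb_def
  proof (rule degree_sum_less)
    show "0 < d" using w(1) by auto
    then show "degree (smult (w i) (poly_shift (i + 1) p)) < d" if "i \<in> {..<d}" for i
      using p(1)
      by (intro le_less_trans[OF degree_smult_le] le_less_trans[OF degree_le[of "d - 1"]])
        (auto simp: coeff_poly_shift coeff_eq_0)
  qed
  ultimately have "comb p = 0" using dvd by (metis dvd_imp_degree_le leD)
  then show False
    using poly_shifts_independent[OF p(1,2)] w(1) unfolding comb_def by blast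
qed

lemma coprime_if_no_common_root:
  fixes p q :: "'a::{alg_closed_field, field_gcd} poly"
  assumes "p \<noteq> 0" "\<And>t. poly p t = 0 \<Longrightarrow> poly q t \<noteq> 0"
  shows "coprime p q"
proof (rule coprimeI)
  fix g assume g: "g dvd p" "g dvd q"
  have "degree g = 0"
  proof (rule ccontr)
    assume "degree g \<noteq> 0"
    then obtain t where "poly g t = 0" using alg_closed_imp_poly_has_root by blast
    then show False using g assms(2)[of t] by (meson dvd_trans poly_eq_0_iff_dvd)
  qed
  moreover have "g \<noteq> 0" using g(1) assms(1) by auto
  ultimately show "is_unit g" by (simp add: is_unit_iff_degree)
qed

lemma bezout_det_eq_0_if_common_root:
  fixes p q :: "'a::idom poly"
  assumes "d > 0" "degree p \<le> d" "degree q \<le> d" "poly p t = 0" "poly q t = 0"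
  shows "bezout_det d (coeff p) (coeff q) = 0"
proof -
  have "(\<Sum>k<d. coeff (bezout_row p q (i + 1)) k * t ^ k) = 0" if "i < d" for i
  proof -
    have deg: "degree (bezout_row p q (i + 1)) < d"
      using that assms by (intro degree_bezout_row_less) auto
    have "(\<Sum>k<d. coeff (bezout_row p q (i + 1)) k * t ^ k) = poly (bezout_row p q (i + 1)) t"
      unfolding poly_altdef using deg
      by (intro sum.mono_neutral_right) (auto simp: coeff_eq_0)
    then show ?thesis using assms(4,5) by (simp add: bezout_row_def)
  qed
  then show ?thesis
    unfolding bezout_det_def det_mat_eq_0_iff_kernel using assms
    by (intro exI[of _ "\<lambda>k. t ^ k"]) (auto simp: bezout_entry_eq_coeff)
qed

lemma bezout_det_eq_0_if_top_coeffs_0: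
  fixes a b :: "nat \<Rightarrow> 'a::idom"
  assumes "d > 0" "a d = 0" "b d = 0"
  shows "bezout_det d a b = 0"
proof -
  have "bezout_entry d a b d k = 0" for k using assms(2,3) by (simp add: bezout_entry_def)
  then have "(\<Sum>i<d. of_bool (i = d - 1) * bezout_entry d a b (i + 1) k) = 0" for k
    using assms(1) by (intro sum.neutral) auto
  then show ?thesis
    unfolding bezout_det_def det_mat_eq_0_iff_rows_dependent using assms(1)
    by (intro exI[of _ "\<lambda>i. of_bool (i = d - 1)"]) (auto intro!: exI[of _ "d - 1"])
qed

theorem bezout_det_eq_0_iff:
  fixes p q :: "'a::{alg_closed_field, field_gcd} poly"
  assumes "d > 0" "degree p \<le> d" "degree q \<le> d"
  shows "bezout_det d (coeff p) (coeff q) = 0 \<longleftrightarrow>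
    (coeff p d = 0 \<and> coeff q d = 0) \<or> (\<exists>t. poly p t = 0 \<and> poly q t = 0)" (is "?lhs \<longleftrightarrow> ?rhs")
proof
  assume lhs: ?lhs
  then have swapped: "bezout_det d (coeff q) (coeff p) = 0"
    using bezout_det_swap[of d "coeff q"] by simp
  show ?rhs
  proof (rule ccontr)
    assume no_common: "\<not> ?rhs"
    then consider "coeff p d \<noteq> 0" | "coeff q d \<noteq> 0" by blast
    then show False
    proof cases
      assume p: "coeff p d \<noteq> 0"
      then have "coprime p q" using no_common by (intro coprime_if_no_common_root) auto
      then show False using bezout_det_nonzero[of p d q] p assms lhs by blast
    next
      assume q: "coeff q d \<noteq> 0"
      then have "coprime q p" using no_common by (intro coprime_if_no_common_root) auto
      then show False using bezout_det_nonzero[of q d p] q assms swapped by blast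
    qed
  qed
next
  assume ?rhs
  then show ?lhs
    using assms bezout_det_eq_0_if_common_root bezout_det_eq_0_if_top_coeffs_0 by blast
qed

section \<open>Projective space\<close>

lemma proj_pt_self: "v \<in> proj_pt v"
  unfolding proj_pt_def by (auto intro!: exI[of _ 1])

lemma proj_pt_eq_iff: "proj_pt u = proj_pt v \<longleftrightarrow> (\<exists>c. c \<noteq> 0 \<and> u = (\<lambda>i. c * v i))"
proof
  assume "proj_pt u = proj_pt v"
  then have "u \<in> proj_pt v" using proj_pt_self[of u] by simp
  then show "\<exists>c. c \<noteq> 0 \<and> u = (\<lambda>i. c * v i)" by (auto simp: proj_pt_def)
next
  assume "\<exists>c. c \<noteq> 0 \<and> u = (\<lambda>i. c * v i)"
  then obtain c where scaling: "c \<noteq> 0" "u = (\<lambda>i. c * v i)" by blast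
  have subset: "proj_pt (\<lambda>i. k * w i) \<subseteq> proj_pt w" if "k \<noteq> 0" for k and w :: "'a \<Rightarrow> complex"
  proof
    fix z assume "z \<in> proj_pt (\<lambda>i. k * w i)"
    then obtain l where "l \<noteq> 0" "z = (\<lambda>i. (l * k) * w i)" by (auto simp: proj_pt_def mult.assoc)
    then show "z \<in> proj_pt w" using that unfolding proj_pt_def by fastforce
  qed
  have "v = (\<lambda>i. inverse c * u i)" using scaling by auto
  then show "proj_pt u = proj_pt v"
    using subset[of c v] subset[of "inverse c" u] scaling by auto
qed

lemma proj_pt_in_space: "proj_pt v \<in> proj_space \<longleftrightarrow> v \<noteq> (\<lambda>_. 0)"
proof
  assume "proj_pt v \<in> proj_space"
  then obtain u where "u \<noteq> (\<lambda>_. 0)" "proj_pt u = proj_pt v" by (auto simp: proj_space_def)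
  then show "v \<noteq> (\<lambda>_. 0)" by (auto simp: proj_pt_eq_iff)
qed (auto simp: proj_space_def)

lemma proj_spaceE:
  assumes "y \<in> proj_space"
  obtains v where "y = proj_pt v" "v \<noteq> (\<lambda>_. 0)"
  using assms by (auto simp: proj_space_def)

lemma proj_pt_eq_iff_minors:
  assumes "u \<noteq> (\<lambda>_. 0)" "v i \<noteq> 0"
  shows "proj_pt u = proj_pt v \<longleftrightarrow> (\<forall>j. v i * u j = u i * v j)"
proof
  assume minors: "\<forall>j. v i * u j = u i * v j"
  then have u: "u = (\<lambda>j. u i / v i * v j)" using assms(2) by (auto simp: field_simps)
  then have "u i / v i \<noteq> 0" using assms(1) by (metis mult_zero_left)
  then show "proj_pt u = proj_pt v" using u unfolding proj_pt_eq_iff by blast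
qed (auto simp: proj_pt_eq_iff)

lemma proj_pt_in_zeros:
  assumes "\<forall>p\<in>S. \<exists>k. homogeneous k p"
  shows "proj_pt v \<in> proj_zeros S \<longleftrightarrow> v \<noteq> (\<lambda>_. 0) \<and> (\<forall>p\<in>S. ceval v p = 0)"
proof -
  have "ceval u p = 0" if "p \<in> S" "u \<in> proj_pt v" "ceval v p = 0" for p u
    using that assms ceval_homogeneous_scale by (fastforce simp: proj_pt_def)
  then show ?thesis
    using proj_pt_self[of v] by (auto simp: proj_zeros_def proj_pt_in_space)
qed

lemma proj_pt_in_hyperplane:
  "proj_pt v \<in> hyperplane (proj_pt a) \<longleftrightarrow> v \<noteq> (\<lambda>_. 0) \<and> dotp a v = 0"
proof -
  have "dotp a' v' = 0" if "a' \<in> proj_pt a" "v' \<in> proj_pt v" "dotp a v = 0" for a' v'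
    using that by (auto simp: proj_pt_def dotp_scale_left dotp_scale_right)
  then show ?thesis
    using proj_pt_self[of v] proj_pt_self[of a]
    by (auto simp: hyperplane_def proj_pt_in_space simp flip: dotp_def)
qed

lemma proj_pt_in_biproj_zeros:
  assumes "bihomogeneous k l Q"
  shows "(proj_pt a, proj_pt b) \<in> biproj_zeros Q \<longleftrightarrow>
    a \<noteq> (\<lambda>_. 0) \<and> b \<noteq> (\<lambda>_. 0) \<and> ceval (case_sum a b) Q = 0"
proof -
  have "ceval (case_sum a' b') Q = 0"
    if "a' \<in> proj_pt a" "b' \<in> proj_pt b" "ceval (case_sum a b) Q = 0" for a' b'
    using that ceval_bihomogeneous_scale[OF assms] by (auto simp: proj_pt_def)
  then show ?thesis
    using proj_pt_self[of a] proj_pt_self[of b] by (auto simp: biproj_zeros_def proj_pt_in_space)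
qed

text \<open>For \<open>u i \<noteq> 0\<close> these are, up to scaling, all linear forms vanishing at \<open>u\<close>.\<close>

definition perp :: "'v::finite \<Rightarrow> ('v \<Rightarrow> complex) \<Rightarrow> ('v \<Rightarrow> complex) \<Rightarrow> 'v \<Rightarrow> complex" where
  "perp i w u = (\<lambda>j. u i * w j - dotp w u * coord_form i j)"

lemma dotp_perp: "dotp (perp i w u) z = u i * dotp w z - dotp w u * z i"
  unfolding perp_def dotp_diff_left dotp_scale_left by simp

lemma perp_eq_scale: "dotp w u = 0 \<Longrightarrow> perp i w u = (\<lambda>j. u i * w j)"
  by (simp add: perp_def)

lemma ex_dotp_separating:
  assumes u: "u \<noteq> (\<lambda>_. 0)" and Z: "finite Z" "(\<lambda>_. 0) \<notin> Z" "proj_pt u \<notin> proj_pt ` Z"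
  obtains a where "dotp a u = 0" "\<And>z. z \<in> Z \<Longrightarrow> dotp a z \<noteq> 0"
proof -
  obtain i where i: "u i \<noteq> 0" using u by auto
  define minors where "minors z = (\<lambda>j. u i * z j - z i * u j)" for z
  have "minors z \<noteq> (\<lambda>_. 0)" if "z \<in> Z" for z
  proof -
    have "z \<noteq> (\<lambda>_. 0)" "proj_pt z \<noteq> proj_pt u" using that Z(2,3) by auto
    then show ?thesis
      using proj_pt_eq_iff_minors[of z u i] i by (auto simp: minors_def fun_eq_iff)
  qed
  then have "(\<lambda>_. 0) \<notin> minors ` Z" by (metis imageE)
  then obtain w where w: "\<And>z. z \<in> minors ` Z \<Longrightarrow> dotp w z \<noteq> 0"
    using ex_dotp_nonzero[of "minors ` Z"] Z(1) by blast
  have "dotp (perp i w u) z = dotp w (minors z)" for z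
    unfolding dotp_perp minors_def dotp_diff_right dotp_scale_right by simp
  then have "dotp (perp i w u) z \<noteq> 0" if "z \<in> Z" for z
    using w that by simp
  moreover have "dotp (perp i w u) u = 0" by (simp add: dotp_perp)
  ultimately show ?thesis by (rule that[rotated])
qed

subsection \<open>The Zariski topology\<close>

lemma zariski_closed_subset: "zariski_closed Z \<Longrightarrow> Z \<subseteq> proj_space"
  by (auto simp: zariski_closed_def proj_zeros_def)

lemma zariski_closedI:
  assumes "\<And>p. p \<in> S \<Longrightarrow> \<exists>k. homogeneous k p" "Z \<subseteq> proj_space"
    and "\<And>v. v \<noteq> (\<lambda>_. 0) \<Longrightarrow> proj_pt v \<in> Z \<longleftrightarrow> (\<forall>p\<in>S. ceval v p = 0)"
  shows "zariski_closed Z"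
proof -
  have "y \<in> Z \<longleftrightarrow> y \<in> proj_zeros S" if "y \<in> proj_space" for y
    using that assms(1,3) by (elim proj_spaceE) (simp add: proj_pt_in_zeros)
  then have "Z = proj_zeros S" using assms(2) by (auto simp: proj_zeros_def)
  then show ?thesis unfolding zariski_closed_def using assms(1) by blast
qed

lemma zariski_closedE:
  assumes "zariski_closed Z"
  obtains S where "\<And>p. p \<in> S \<Longrightarrow> \<exists>k. homogeneous k p"
    "\<And>v. v \<noteq> (\<lambda>_. 0) \<Longrightarrow> proj_pt v \<in> Z \<longleftrightarrow> (\<forall>p\<in>S. ceval v p = 0)"
proof -
  obtain S where S: "\<forall>p\<in>S. \<exists>k. homogeneous k p" "Z = proj_zeros S"
    using assms unfolding zariski_closed_def by blast
  show ?thesis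
    using that[of S] S(1) by (simp add: S(2) proj_pt_in_zeros[OF S(1)])
qed

lemma zariski_closed_Un:
  assumes "zariski_closed Y" "zariski_closed Z"
  shows "zariski_closed (Y \<union> Z)"
proof -
  obtain S where S: "\<And>p. p \<in> S \<Longrightarrow> \<exists>k. homogeneous k p"
    "\<And>v. v \<noteq> (\<lambda>_. 0) \<Longrightarrow> proj_pt v \<in> Y \<longleftrightarrow> (\<forall>p\<in>S. ceval v p = 0)"
    using zariski_closedE[OF assms(1)] by blast
  obtain T where T: "\<And>p. p \<in> T \<Longrightarrow> \<exists>k. homogeneous k p"
    "\<And>v. v \<noteq> (\<lambda>_. 0) \<Longrightarrow> proj_pt v \<in> Z \<longleftrightarrow> (\<forall>p\<in>T. ceval v p = 0)"
    using zariski_closedE[OF assms(2)] by blast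
  let ?ST = "(\<lambda>(p, q). p * q) ` (S \<times> T)"
  show ?thesis
  proof (rule zariski_closedI[where S = ?ST])
    show "\<exists>k. homogeneous k p" if "p \<in> ?ST" for p
      using that S(1) T(1) total.homogeneous_mult by fastforce
    show "Y \<union> Z \<subseteq> proj_space" using assms by (simp add: zariski_closed_subset)
    show "proj_pt v \<in> Y \<union> Z \<longleftrightarrow> (\<forall>p\<in>?ST. ceval v p = 0)"
      if "v \<noteq> (\<lambda>_. 0)" for v
      using S(2)[OF that] T(2)[OF that] by (auto simp: ceval_mult)
  qed
qed

lemma zariski_closed_empty: "zariski_closed {}"
proof (rule zariski_closedI[where S = "{1}"])
  show "\<exists>k. homogeneous k p" if "p \<in> {1}" for p
    using that total.homogeneous_cconst[of 1] by (auto simp: cconst_1)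
qed simp_all

lemma zariski_closed_singleton:
  assumes "y \<in> proj_space"
  shows "zariski_closed {y}"
proof -
  obtain v where v: "y = proj_pt v" "v \<noteq> (\<lambda>_. 0)" using assms by (rule proj_spaceE)
  then obtain i where i: "v i \<noteq> 0" by auto
  let ?S = "range (\<lambda>j. cvar j * cconst (v i) - cvar i * cconst (v j))"
  show ?thesis
  proof (rule zariski_closedI[where S = ?S])
    show "\<exists>k. homogeneous k p" if "p \<in> ?S" for p
      using that total.homogeneous_diff total.homogeneous_mult_cconst homogeneous_cvar by blast
    show "{y} \<subseteq> proj_space" using assms by simp
    show "proj_pt u \<in> {y} \<longleftrightarrow> (\<forall>p\<in>?S. ceval u p = 0)" if "u \<noteq> (\<lambda>_. 0)" for u
      using proj_pt_eq_iff_minors[OF that, of v i] i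
      by (auto simp: v(1) ceval.hom_minus ceval_mult mult.commute)
  qed
qed

lemma zariski_closed_finite:
  assumes "finite Z" "Z \<subseteq> proj_space"
  shows "zariski_closed Z"
  using assms
proof (induction Z rule: finite_induct)
  case (insert y Z)
  then show ?case
    using zariski_closed_Un[OF zariski_closed_singleton[of y], of Z] by simp
qed (rule zariski_closed_empty)

lemma irreducible_closed_singleton: "y \<in> proj_space \<Longrightarrow> irreducible_closed {y}"
  unfolding irreducible_closed_def by (simp add: zariski_closed_singleton)

lemma irreducible_closed_finite:
  assumes "irreducible_closed Z" "finite Z"
  obtains y where "Z = {y}"
proof -
  obtain y where y: "y \<in> Z" using assms(1) unfolding irreducible_closed_def by blast
  have "Z \<subseteq> proj_space"
    using assms(1) by (simp add: irreducible_closed_def zariski_closed_subset)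
  then have "zariski_closed {y}" "zariski_closed (Z - {y})"
    using y assms(2) by (auto intro!: zariski_closed_finite)
  moreover have "Z \<subseteq> {y} \<union> (Z - {y})" by blast
  ultimately have "Z \<subseteq> {y} \<or> Z \<subseteq> Z - {y}"
    using assms(1) unfolding irreducible_closed_def by blast
  then show ?thesis using y that by blast
qed

lemma has_degree_unique:
  fixes C :: "('v::finite) ppoint set"
  assumes "has_degree C d" "has_degree C d'"
  shows "d = d'"
proof -
  obtain G k where G: "homogeneous k G" "G \<noteq> 0"
    "\<And>\<alpha>. \<alpha> \<in> proj_space - proj_zeros {G} \<Longrightarrow> card (C \<inter> hyperplane \<alpha>) = d"
    using assms(1) unfolding has_degree_def by blast
  obtain G' k' where G': "homogeneous k' G'" "G' \<noteq> 0"
    "\<And>\<alpha>. \<alpha> \<in> proj_space - proj_zeros {G'} \<Longrightarrow> card (C \<inter> hyperplane \<alpha>) = d'"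
    using assms(2) unfolding has_degree_def by blast
  define i :: 'v where "i = undefined"
  have "\<exists>x. (\<Prod>p\<in>{G, G', cvar i}. ceval x p) \<noteq> 0"
  proof (rule poly_on_lines_prod_nonzero_ex[where f = "\<lambda>p x. ceval x p"])
    fix p assume "p \<in> {G, G', cvar i}"
    moreover have "ceval (\<lambda>_. 1) (cvar i) \<noteq> 0" by simp
    ultimately show "\<exists>x. ceval x p \<noteq> 0" using G(2) G'(2) ceval_nonzero_ex by blast
  qed (auto simp: poly_on_lines_ceval)
  then obtain x where "\<forall>p\<in>{G, G', cvar i}. ceval x p \<noteq> 0" by auto
  then have x: "ceval x G \<noteq> 0" "ceval x G' \<noteq> 0" "x i \<noteq> 0" by simp_all
  then have "x \<noteq> (\<lambda>_. 0)" by auto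
  then have "proj_pt x \<in> proj_space - proj_zeros {G}" "proj_pt x \<in> proj_space - proj_zeros {G'}"
    using x(1,2) proj_pt_self[of x] by (auto simp: proj_pt_in_space proj_zeros_def)
  then show ?thesis using G(3) G'(3) by metis
qed

lemma chow_point_scale:
  assumes "Q \<in> chow_point C" "k \<noteq> 0"
  shows "cconst k * Q \<in> chow_point C"
proof -
  obtain d where Q: "irreducible_curve C" "Q \<noteq> 0" "has_degree C d" "bihomogeneous d d Q"
    "biproj_zeros Q = chow_hypersurface C"
    using assms(1) by (auto simp: chow_point_def)
  have ceval_scale: "ceval x (cconst k * Q) = k * ceval x Q" for x by (simp add: ceval_mult)
  obtain x where "ceval x Q \<noteq> 0" using Q(2) by (rule ceval_nonzero_ex)
  then have "cconst k * Q \<noteq> 0" using assms(2) ceval_scale[of x] by auto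
  moreover have "bihomogeneous d d (cconst k * Q)"
    using Q(4) unfolding bihomogeneous_iff mult.commute[of "cconst k"]
    by (auto intro: left.homogeneous_mult_cconst right.homogeneous_mult_cconst)
  moreover have "biproj_zeros (cconst k * Q) = biproj_zeros Q"
    using assms(2) by (simp add: biproj_zeros_def ceval_scale)
  ultimately show ?thesis using Q by (auto simp: chow_point_def)
qed

lemma cpoly_class_scale:
  assumes "k \<noteq> 0"
  shows "cpoly_class (cconst k * p) = cpoly_class p"
proof -
  have "cconst a * p = cconst (a / k) * (cconst k * p)" for a
    using assms by (simp flip: mult.assoc cconst_mult)
  moreover have "cconst a * (cconst k * p) = cconst (a * k) * p" for a
    by (simp add: cconst_mult mult.assoc)
  ultimately show ?thesis
    unfolding cpoly_class_def using assms by fastforce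
qed

section \<open>Projective closures of polynomial curves\<close>

definition coeff_vec :: "('v \<Rightarrow> 'a::zero poly) \<Rightarrow> nat \<Rightarrow> 'v \<Rightarrow> 'a" where
  "coeff_vec c l = (\<lambda>j. coeff (c j) l)"

definition pullback :: "('v::finite \<Rightarrow> 'a poly) \<Rightarrow> ('v \<Rightarrow> 'a) \<Rightarrow> 'a::comm_ring_1 poly" where
  "pullback c a = (\<Sum>j\<in>UNIV. smult (a j) (c j))"

lemma coeff_pullback: "coeff (pullback c a) l = dotp a (coeff_vec c l)"
  by (simp add: pullback_def dotp_def coeff_vec_def coeff_sum)

lemma poly_pullback: "poly (pullback c a) t = dotp a (\<lambda>j. poly (c j) t)"
  by (simp add: pullback_def dotp_def poly_sum)

lemma degree_pullback_le: "(\<And>j. degree (c j) \<le> d) \<Longrightarrow> degree (pullback c a) \<le> d"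
  unfolding pullback_def by (intro degree_sum_le order_trans[OF degree_smult_le]) auto

lemma pderiv_pullback: "pderiv (pullback c a) = pullback (\<lambda>j. pderiv (c j)) a"
  by (rule poly_eqI)
    (simp add: coeff_pderiv coeff_pullback coeff_vec_def dotp_def sum_distrib_left algebra_simps)

definition reverse_poly :: "nat \<Rightarrow> 'a poly \<Rightarrow> 'a::field poly" where
  "reverse_poly d p = monom 1 (d - degree p) * reflect_poly p"

lemma poly_reverse_poly:
  assumes "degree p \<le> d" "s \<noteq> 0"
  shows "poly (reverse_poly d p) s = s ^ d * poly p (inverse s)"
proof -
  have "s ^ (d - degree p) * s ^ degree p = s ^ d" using assms(1) by (simp flip: power_add)
  then show ?thesis
    using assms(2) by (simp add: reverse_poly_def poly_monom poly_reflect_poly_nz flip: mult.assoc)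
qed

lemma poly_reverse_poly_0: "degree p \<le> d \<Longrightarrow> poly (reverse_poly d p) 0 = coeff p d"
  by (cases "degree p = d") (auto simp: reverse_poly_def poly_monom coeff_eq_0 power_0_left)

locale poly_curve =
  fixes c :: "'v::finite \<Rightarrow> complex poly" and d :: nat and o\<^sub>0 :: 'v
  assumes degree_c_le: "degree (c j) \<le> d"
    and top_nonzero: "coeff_vec c d \<noteq> (\<lambda>_. 0)"
    and c_o_eq_1: "c o\<^sub>0 = 1"
    and inj_curve: "inj (\<lambda>t j. poly (c j) t)"
begin

definition \<gamma> :: "complex \<Rightarrow> 'v \<Rightarrow> complex" where
  "\<gamma> t = (\<lambda>j. poly (c j) t)"

definition curve :: "'v ppoint set" where
  "curve = insert (proj_pt (coeff_vec c d)) (range (\<lambda>t. proj_pt (\<gamma> t)))"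

abbreviation bez :: "('v \<Rightarrow> complex) \<Rightarrow> ('v \<Rightarrow> complex) \<Rightarrow> complex" where
  "bez a b \<equiv> bezout_det d (coeff (pullback c a)) (coeff (pullback c b))"

lemma inj_\<gamma>: "inj \<gamma>"
  using inj_curve unfolding \<gamma>_def .

lemma d_pos: "d > 0"
proof (rule ccontr)
  assume "\<not> d > 0"
  then have "degree (c j) = 0" for j using degree_c_le[of j] by simp
  then have "poly (c j) 0 = poly (c j) 1" for j by (metis degree_0_id poly_const_conv)
  then have "\<gamma> 0 = \<gamma> 1" by (simp add: \<gamma>_def)
  then show False using inj_\<gamma> by (auto dest: injD)
qed

lemma \<gamma>_o_eq_1: "\<gamma> t o\<^sub>0 = 1"
  by (simp add: \<gamma>_def c_o_eq_1)

lemma \<gamma>_nonzero: "\<gamma> t \<noteq> (\<lambda>_. 0)"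
  using \<gamma>_o_eq_1[of t] by auto

lemma top_o_eq_0: "coeff_vec c d o\<^sub>0 = 0"
  using d_pos by (simp add: coeff_vec_def c_o_eq_1)

lemma inj_proj_\<gamma>: "inj (\<lambda>t. proj_pt (\<gamma> t))"
proof (rule injI)
  fix s t assume "proj_pt (\<gamma> s) = proj_pt (\<gamma> t)"
  then obtain k where k: "\<gamma> s = (\<lambda>i. k * \<gamma> t i)" unfolding proj_pt_eq_iff by blast
  then have "k = 1" using \<gamma>_o_eq_1[of s] \<gamma>_o_eq_1[of t] by (metis mult.right_neutral)
  then have "\<gamma> s = \<gamma> t" using k by simp
  then show "s = t" using inj_\<gamma> by (simp add: inj_def)
qed

lemma curve_subset: "curve \<subseteq> proj_space"
  by (auto simp: curve_def proj_pt_in_space top_nonzero \<gamma>_nonzero)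

lemma poly_pullback_\<gamma>: "poly (pullback c a) t = dotp a (\<gamma> t)"
  by (simp add: poly_pullback \<gamma>_def)

lemma degree_pullback_c_le: "degree (pullback c a) \<le> d"
  by (rule degree_pullback_le) (rule degree_c_le)

lemma bez_eq_0_iff:
  "bez a b = 0 \<longleftrightarrow> (dotp a (coeff_vec c d) = 0 \<and> dotp b (coeff_vec c d) = 0) \<or>
    (\<exists>t. dotp a (\<gamma> t) = 0 \<and> dotp b (\<gamma> t) = 0)"
  using bezout_det_eq_0_iff[OF d_pos degree_pullback_c_le degree_pullback_c_le, of a b]
  by (simp add: coeff_pullback poly_pullback_\<gamma>)

lemma bez_eq_0_iff_meet_on_curve:
  assumes "a \<noteq> (\<lambda>_. 0)" "b \<noteq> (\<lambda>_. 0)"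
  shows "bez a b = 0 \<longleftrightarrow> (\<exists>y\<in>curve. y \<in> hyperplane (proj_pt a) \<and> y \<in> hyperplane (proj_pt b))"
  unfolding bez_eq_0_iff by (auto simp: curve_def proj_pt_in_hyperplane top_nonzero \<gamma>_nonzero)

lemma finite_hyperplane_parameters:
  assumes "dotp a (coeff_vec c d) \<noteq> 0"
  shows "finite {t. dotp a (\<gamma> t) = 0}"
proof -
  have "pullback c a \<noteq> 0" using assms by (metis coeff_0 coeff_pullback)
  then show ?thesis using poly_roots_finite[of "pullback c a"] by (simp add: poly_pullback_\<gamma>)
qed

text \<open>The point at infinity is handled by the substitution \<open>t = 1 / s\<close>.\<close>

lemma homogeneous_vanishes_on_curve:
  assumes hom: "homogeneous k p" and inf: "infinite {t. ceval (\<gamma> t) p = 0}"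
  shows "ceval (\<gamma> t) p = 0" and "ceval (coeff_vec c d) p = 0"
proof -
  have "poly_subst c p = 0"
    using inf poly_roots_finite[of "poly_subst c p"] by (auto simp: poly_poly_subst \<gamma>_def)
  then have zero: "ceval (\<gamma> t) p = 0" for t
    using poly_poly_subst[of c p t] by (simp add: \<gamma>_def)
  then show "ceval (\<gamma> t) p = 0" .
  define r where "r = poly_subst (\<lambda>j. reverse_poly d (c j)) p"
  have "poly r s = 0" if "s \<noteq> 0" for s
  proof -
    have "poly r s = ceval (\<lambda>j. s ^ d * \<gamma> (inverse s) j) p"
      using that by (simp add: r_def poly_poly_subst poly_reverse_poly degree_c_le \<gamma>_def)
    then show ?thesis by (simp add: ceval_homogeneous_scale[OF hom] zero)
  qed
  then have "UNIV - {0} \<subseteq> {s. poly r s = 0}" by auto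
  moreover have "infinite (UNIV - {0 :: complex})" by (simp add: infinite_UNIV_char_0)
  ultimately have "r = 0" using poly_roots_finite[of r] finite_subset by blast
  then have "poly r 0 = 0" by simp
  then show "ceval (coeff_vec c d) p = 0"
    by (simp add: r_def poly_poly_subst poly_reverse_poly_0 degree_c_le coeff_vec_def)
qed

lemma curve_subset_closed:
  assumes "zariski_closed Z" "infinite {t. proj_pt (\<gamma> t) \<in> Z}"
  shows "curve \<subseteq> Z"
proof -
  obtain S where S: "\<And>p. p \<in> S \<Longrightarrow> \<exists>k. homogeneous k p"
    "\<And>v. v \<noteq> (\<lambda>_. 0) \<Longrightarrow> proj_pt v \<in> Z \<longleftrightarrow> (\<forall>p\<in>S. ceval v p = 0)"
    using zariski_closedE[OF assms(1)] by blast
  have "ceval (\<gamma> t) p = 0 \<and> ceval (coeff_vec c d) p = 0" if p: "p \<in> S" for p t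
  proof -
    obtain k where k: "homogeneous k p" using S(1) p by blast
    have "{t. proj_pt (\<gamma> t) \<in> Z} \<subseteq> {t. ceval (\<gamma> t) p = 0}"
      using S(2) \<gamma>_nonzero p by blast
    then have "infinite {t. ceval (\<gamma> t) p = 0}" using assms(2) finite_subset by blast
    then show ?thesis using homogeneous_vanishes_on_curve[OF k] by blast
  qed
  then show ?thesis by (auto simp: curve_def S(2) top_nonzero \<gamma>_nonzero)
qed

text \<open>A point off the curve lies on a hyperplane that misses the point at infinity and hence meets
  the curve in finitely many points, which another hyperplane through the point avoids.\<close>

lemma proj_pt_in_curve_iff:
  assumes u: "u \<noteq> (\<lambda>_. 0)"
  shows "proj_pt u \<in> curve \<longleftrightarrow> (\<forall>a b. dotp a u = 0 \<longrightarrow> dotp b u = 0 \<longrightarrow> bez a b = 0)"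
proof
  assume "proj_pt u \<in> curve"
  then obtain z where "proj_pt z = proj_pt u" and z: "z = coeff_vec c d \<or> z \<in> range \<gamma>"
    unfolding curve_def by auto
  then obtain k where "z = (\<lambda>i. k * u i)" unfolding proj_pt_eq_iff by blast
  then have "dotp a z = 0" if "dotp a u = 0" for a
    using that by (simp add: dotp_scale_right)
  then show "\<forall>a b. dotp a u = 0 \<longrightarrow> dotp b u = 0 \<longrightarrow> bez a b = 0"
    using z unfolding bez_eq_0_iff by blast
next
  assume all: "\<forall>a b. dotp a u = 0 \<longrightarrow> dotp b u = 0 \<longrightarrow> bez a b = 0"
  show "proj_pt u \<in> curve"
  proof (rule ccontr)
    assume off: "proj_pt u \<notin> curve"
    obtain a where a: "dotp a u = 0" "dotp a (coeff_vec c d) \<noteq> 0"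
      by (rule ex_dotp_separating[of u "{coeff_vec c d}"])
        (use u off top_nonzero in \<open>auto simp: curve_def\<close>)
    obtain b where b: "dotp b u = 0" "\<And>t. dotp a (\<gamma> t) = 0 \<Longrightarrow> dotp b (\<gamma> t) \<noteq> 0"
    proof (rule ex_dotp_separating[of u "\<gamma> ` {t. dotp a (\<gamma> t) = 0}"])
      show "finite (\<gamma> ` {t. dotp a (\<gamma> t) = 0})"
        using finite_hyperplane_parameters[OF a(2)] by simp
      show "(\<lambda>_. 0) \<notin> \<gamma> ` {t. dotp a (\<gamma> t) = 0}" by (metis \<gamma>_nonzero imageE)
      show "proj_pt u \<notin> proj_pt ` \<gamma> ` {t. dotp a (\<gamma> t) = 0}" using off by (auto simp: curve_def)
    qed (use u in auto)
    have "bez a b \<noteq> 0" unfolding bez_eq_0_iff using a(2) b(2) by blast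
    then show False using all a(1) b(1) by blast
  qed
qed

text \<open>By \<open>proj_pt_in_curve_iff\<close> the curve is cut out by the Bezout determinants of the pairs of
  forms \<open>perp i w u\<close> and \<open>perp i w' u\<close>, whose coefficients are linear forms in \<open>u\<close>.\<close>

definition perp_coeff :: "'v \<Rightarrow> ('v \<Rightarrow> complex) \<Rightarrow> nat \<Rightarrow> 'v cpoly" where
  "perp_coeff i w l =
     cvar i * cconst (dotp w (coeff_vec c l)) - lin_form id w * cconst (coeff_vec c l i)"

lemma ceval_perp_coeff: "ceval u (perp_coeff i w l) = coeff (pullback c (perp i w u)) l"
  by (simp add: perp_coeff_def coeff_pullback dotp_perp ceval.hom_minus ceval_mult ceval_lin_form)
    (simp add: dotp_def mult.commute)

lemma homogeneous_perp_coeff: "homogeneous 1 (perp_coeff i w l)"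
  unfolding perp_coeff_def
  by (intro total.homogeneous_diff total.homogeneous_mult_cconst homogeneous_cvar
      homogeneous_lin_form_id)

lemma zariski_closed_curve: "zariski_closed curve"
proof (rule zariski_closedI[OF _ curve_subset])
  let ?S = "range (\<lambda>(i, w, w'). bezout_det d (perp_coeff i w) (perp_coeff i w'))"
  show "\<exists>k. homogeneous k p" if "p \<in> ?S" for p
    using that total.homogeneous_bezout_det homogeneous_perp_coeff by fastforce
  fix u :: "'v \<Rightarrow> complex" assume u: "u \<noteq> (\<lambda>_. 0)"
  have "(\<forall>p\<in>?S. ceval u p = 0) \<longleftrightarrow> (\<forall>i w w'. bez (perp i w u) (perp i w' u) = 0)"
    by (simp add: ceval.hom_bezout_det ceval_perp_coeff)
  also have "\<dots> \<longleftrightarrow> (\<forall>a b. dotp a u = 0 \<longrightarrow> dotp b u = 0 \<longrightarrow> bez a b = 0)"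
  proof (intro iffI allI impI)
    fix a b assume all: "\<forall>i w w'. bez (perp i w u) (perp i w' u) = 0"
      and ab: "dotp a u = 0" "dotp b u = 0"
    obtain i where "u i \<noteq> 0" using u by auto
    moreover have "bez (\<lambda>j. u i * a j) (\<lambda>j. u i * b j) = 0"
      using all[rule_format, of i a b] by (simp only: perp_eq_scale ab)
    ultimately show "bez a b = 0" by (simp add: bez_eq_0_iff dotp_scale_left)
  qed (simp add: dotp_perp)
  also have "\<dots> \<longleftrightarrow> proj_pt u \<in> curve" by (simp add: proj_pt_in_curve_iff[OF u])
  finally show "proj_pt u \<in> curve \<longleftrightarrow> (\<forall>p\<in>?S. ceval u p = 0)" by simp
qed

lemma closure_curve: "zariski_closed hull (range (\<lambda>t. proj_pt (\<gamma> t))) = curve"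
proof (rule hull_unique)
  show "range (\<lambda>t. proj_pt (\<gamma> t)) \<subseteq> curve" by (auto simp: curve_def)
  fix Z assume "range (\<lambda>t. proj_pt (\<gamma> t)) \<subseteq> Z" and Z: "zariski_closed Z"
  then have "{t. proj_pt (\<gamma> t) \<in> Z} = UNIV" by auto
  then show "curve \<subseteq> Z" using curve_subset_closed[OF Z] by (simp add: infinite_UNIV_char_0)
qed (rule zariski_closed_curve)

lemma irreducible_closed_curve: "irreducible_closed curve"
  unfolding irreducible_closed_def
proof (intro conjI allI impI)
  show "zariski_closed curve" by (rule zariski_closed_curve)
  show "curve \<noteq> {}" by (simp add: curve_def)
  fix Y Z assume YZ: "zariski_closed Y \<and> zariski_closed Z \<and> curve \<subseteq> Y \<union> Z"
  then have "UNIV = {t. proj_pt (\<gamma> t) \<in> Y} \<union> {t. proj_pt (\<gamma> t) \<in> Z}"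
    by (auto simp: curve_def)
  then have "infinite {t. proj_pt (\<gamma> t) \<in> Y} \<or> infinite {t. proj_pt (\<gamma> t) \<in> Z}"
    using infinite_UNIV_char_0[where 'a = complex] by (metis finite_UnI)
  then show "curve \<subseteq> Y \<or> curve \<subseteq> Z" using YZ curve_subset_closed by blast
qed

lemma finite_closed_proper_subset:
  assumes "zariski_closed Z" "Z \<subset> curve"
  shows "finite Z"
proof -
  have "finite {t. proj_pt (\<gamma> t) \<in> Z}" using curve_subset_closed assms by blast
  moreover have "Z \<subseteq> insert (proj_pt (coeff_vec c d))
      ((\<lambda>t. proj_pt (\<gamma> t)) ` {t. proj_pt (\<gamma> t) \<in> Z})"
    using assms(2) by (auto simp: curve_def)
  ultimately show ?thesis by (meson finite.insertI finite_imageI finite_subset)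
qed

lemma irreducible_curve_curve: "irreducible_curve curve"
  unfolding irreducible_curve_def
proof (intro conjI notI)
  let ?inf = "proj_pt (coeff_vec c d)"
  have "infinite (range (\<lambda>t. proj_pt (\<gamma> t)))"
    using inj_proj_\<gamma> by (simp add: finite_image_iff infinite_UNIV_char_0)
  then have "infinite curve" unfolding curve_def by simp
  then have "{?inf} \<noteq> curve" by (metis finite.emptyI finite.insertI)
  then have "{?inf} \<subset> curve" by (auto simp: curve_def)
  moreover have "irreducible_closed {?inf}"
    by (simp add: irreducible_closed_singleton proj_pt_in_space top_nonzero)
  ultimately show "\<exists>Z. irreducible_closed Z \<and> Z \<subset> curve" by blast
next
  assume "\<exists>Y Z. irreducible_closed Y \<and> irreducible_closed Z \<and> Y \<subset> Z \<and> Z \<subset> curve"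
  then obtain Y Z where YZ: "irreducible_closed Y" "irreducible_closed Z" "Y \<subset> Z" "Z \<subset> curve"
    by blast
  then have "finite Z" by (simp add: finite_closed_proper_subset irreducible_closed_def)
  then obtain z where "Z = {z}" using YZ(2) irreducible_closed_finite by blast
  moreover have "Y \<noteq> {}" using YZ(1) by (simp add: irreducible_closed_def)
  ultimately show False using YZ(3) by blast
qed (rule irreducible_closed_curve)

subsection \<open>The degree\<close>

text \<open>The Bezout determinant of a hyperplane section and its derivative plays the role of the
  discriminant; it also vanishes if the hyperplane passes through the point at infinity.\<close>

definition discr :: "'v cpoly" where
  "discr = bezout_det d (\<lambda>l. lin_form id (coeff_vec c l))
     (\<lambda>l. lin_form id (coeff_vec (\<lambda>j. pderiv (c j)) l))"

lemma ceval_discr_nonzero_iff: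
  "ceval a discr \<noteq> 0 \<longleftrightarrow> dotp a (coeff_vec c d) \<noteq> 0 \<and>
    (\<forall>t. \<not> (poly (pullback c a) t = 0 \<and> poly (pderiv (pullback c a)) t = 0))"
proof -
  let ?p = "pullback c a"
  have deg: "degree (pderiv ?p) < d"
    using d_pos degree_pullback_c_le[of a] by (simp add: degree_pderiv)
  have "ceval a discr = bezout_det d (coeff ?p) (coeff (pderiv ?p))"
    by (simp add: discr_def ceval.hom_bezout_det ceval_lin_form pderiv_pullback
        flip: coeff_pullback)
  then show ?thesis
    using bezout_det_eq_0_iff[OF d_pos degree_pullback_c_le, of "pderiv ?p" a] deg
    by (simp add: coeff_eq_0 coeff_pullback)
qed

lemma homogeneous_discr: "homogeneous (d * (1 + 1)) discr"
  unfolding discr_def by (intro total.homogeneous_bezout_det homogeneous_lin_form_id)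

text \<open>Changing the coefficient of the coordinate \<open>o\<^sub>0\<close> shifts the pullback by a constant,
  which can be chosen to avoid the finitely many critical values.\<close>

lemma ceval_discr_nonzero_ex: "\<exists>a. ceval a discr \<noteq> 0"
proof -
  obtain j where j: "coeff (c j) d \<noteq> 0" using top_nonzero by (auto simp: coeff_vec_def)
  then have "degree (c j) > 0" using d_pos by (metis le_degree less_le_trans)
  then have "pderiv (c j) \<noteq> 0" by (simp add: pderiv_eq_0_iff)
  then have "finite ((\<lambda>t. - poly (c j) t) ` {t. poly (pderiv (c j)) t = 0})"
    using poly_roots_finite by blast
  then obtain k where k: "k \<notin> (\<lambda>t. - poly (c j) t) ` {t. poly (pderiv (c j)) t = 0}"
    using ex_new_if_finite[OF infinite_UNIV_char_0] by blast
  define a :: "'v \<Rightarrow> complex" where "a = (\<lambda>i. coord_form j i + k * coord_form o\<^sub>0 i)"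
  have dotp_a: "dotp a v = v j + k * v o\<^sub>0" for v
    unfolding a_def dotp_add_left dotp_scale_left by simp
  have "pullback c a = c j + [:k:]"
    by (rule poly_eqI) (simp add: coeff_pullback dotp_a coeff_vec_def c_o_eq_1 coeff_pCons
        split: nat.split)
  then have "\<not> (poly (pullback c a) t = 0 \<and> poly (pderiv (pullback c a)) t = 0)" for t
    using k by (auto simp: pderiv_add pderiv_pCons image_iff add_eq_0_iff)
  moreover have "dotp a (coeff_vec c d) \<noteq> 0"
    using j top_o_eq_0 by (simp add: dotp_a) (simp add: coeff_vec_def)
  ultimately show ?thesis unfolding ceval_discr_nonzero_iff by blast
qed

lemma card_hyperplane_parameters:
  assumes "ceval a discr \<noteq> 0"
  shows "card {t. dotp a (\<gamma> t) = 0} = d"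
proof -
  let ?p = "pullback c a"
  have top: "coeff ?p d \<noteq> 0" and "rsquarefree ?p"
    using assms unfolding ceval_discr_nonzero_iff by (auto simp: coeff_pullback rsquarefree_roots)
  then have "d = degree (smult (lead_coeff ?p) (\<Prod>z | poly ?p z = 0. [:-z, 1:]))"
    using degree_pullback_c_le[of a]
    by (subst complex_poly_decompose_rsquarefree) (auto intro: antisym le_degree)
  also have "\<dots> = degree (\<Prod>z | poly ?p z = 0. [:-z, 1:])" using top by auto
  also have "\<dots> = (\<Sum>z | poly ?p z = 0. degree [:-z, 1:])"
    by (intro degree_prod_eq_sum_degree) auto
  finally show ?thesis by (simp add: poly_pullback_\<gamma>)
qed

lemma has_degree_curve: "has_degree curve d"
  unfolding has_degree_def
proof (intro exI conjI ballI)
  show "homogeneous (d * (1 + 1)) discr" by (rule homogeneous_discr)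
  show "discr \<noteq> 0" using ceval_discr_nonzero_ex by auto
  fix \<alpha> assume \<alpha>: "\<alpha> \<in> proj_space - proj_zeros {discr}"
  then obtain a where a: "\<alpha> = proj_pt a" "a \<noteq> (\<lambda>_. 0)" by (auto elim: proj_spaceE)
  have discr: "ceval a discr \<noteq> 0"
    using \<alpha> a proj_pt_in_zeros[of "{discr}" a] homogeneous_discr by auto
  then have top: "dotp a (coeff_vec c d) \<noteq> 0" by (simp add: ceval_discr_nonzero_iff)
  then have meet: "curve \<inter> hyperplane \<alpha> = (\<lambda>t. proj_pt (\<gamma> t)) ` {t. dotp a (\<gamma> t) = 0}"
    by (auto simp: a(1) curve_def proj_pt_in_hyperplane \<gamma>_nonzero)
  show "finite (curve \<inter> hyperplane \<alpha>)"
    unfolding meet using finite_hyperplane_parameters[OF top] by simp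
  have "inj_on (\<lambda>t. proj_pt (\<gamma> t)) {t. dotp a (\<gamma> t) = 0}"
    using inj_proj_\<gamma> by (rule inj_on_subset) simp
  then show "card (curve \<inter> hyperplane \<alpha>) = d"
    unfolding meet by (simp add: card_image card_hyperplane_parameters[OF discr])
qed

subsection \<open>The Chow form\<close>

definition chow_form :: "('v + 'v) cpoly" where
  "chow_form = bezout_det d (\<lambda>l. lin_form Inl (coeff_vec c l)) (\<lambda>l. lin_form Inr (coeff_vec c l))"

lemma ceval_chow_form: "ceval (case_sum a b) chow_form = bez a b"
  by (simp add: chow_form_def ceval.hom_bezout_det ceval_lin_form comp_def flip: coeff_pullback)

lemma bihomogeneous_chow_form: "bihomogeneous d d chow_form"
proof -
  have "homogeneous_wrt left_degree (d * (1 + 0)) chow_form"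
    unfolding chow_form_def
    by (intro left.homogeneous_bezout_det left.homogeneous_lin_form)
      (simp_all add: left_degree_def lookup_single when_def)
  moreover have "homogeneous_wrt right_degree (d * (0 + 1)) chow_form"
    unfolding chow_form_def
    by (intro right.homogeneous_bezout_det right.homogeneous_lin_form)
      (simp_all add: right_degree_def lookup_single when_def)
  ultimately show ?thesis by (simp add: bihomogeneous_iff)
qed

lemma biproj_zeros_chow_form: "biproj_zeros chow_form = chow_hypersurface curve"
proof -
  have "(\<alpha>, \<beta>) \<in> biproj_zeros chow_form \<longleftrightarrow> (\<alpha>, \<beta>) \<in> chow_hypersurface curve"
    if \<alpha>\<beta>: "\<alpha> \<in> proj_space" "\<beta> \<in> proj_space" for \<alpha> \<beta>
  proof -
    obtain a b where ab: "\<alpha> = proj_pt a" "a \<noteq> (\<lambda>_. 0)" "\<beta> = proj_pt b" "b \<noteq> (\<lambda>_. 0)"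
      using \<alpha>\<beta> by (metis proj_spaceE)
    then show ?thesis
      using \<alpha>\<beta>
      by (auto simp: proj_pt_in_biproj_zeros[OF bihomogeneous_chow_form] ceval_chow_form
          bez_eq_0_iff_meet_on_curve chow_hypersurface_def)
  qed
  moreover have "biproj_zeros chow_form \<subseteq> proj_space \<times> proj_space"
    "chow_hypersurface curve \<subseteq> proj_space \<times> proj_space"
    by (auto simp: biproj_zeros_def chow_hypersurface_def)
  ultimately show ?thesis by blast
qed

lemma bez_coord_form_nonzero: "dotp a (coeff_vec c d) \<noteq> 0 \<Longrightarrow> bez a (coord_form o\<^sub>0) \<noteq> 0"
  unfolding bez_eq_0_iff by (simp add: \<gamma>_o_eq_1)

lemma bez_nonzero_ex: "\<exists>a. bez a (coord_form o\<^sub>0) \<noteq> 0"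
  using ceval_discr_nonzero_ex ceval_discr_nonzero_iff bez_coord_form_nonzero by blast

lemma chow_form_in_chow_point: "chow_form \<in> chow_point curve"
proof -
  have "chow_form \<noteq> 0" using bez_nonzero_ex by (auto simp flip: ceval_chow_form)
  then show ?thesis
    unfolding chow_point_def
    using irreducible_curve_curve has_degree_curve bihomogeneous_chow_form biproj_zeros_chow_form
    by blast
qed

text \<open>Stated for functions rather than polynomials, so that the two sets of variables can be
  exchanged freely.\<close>

definition chow_vanishing :: "(('v \<Rightarrow> complex) \<Rightarrow> ('v \<Rightarrow> complex) \<Rightarrow> complex) \<Rightarrow> bool" where
  "chow_vanishing q \<longleftrightarrow> (\<forall>a. degree_on_lines_le d (q a)) \<and>
     (\<forall>b. degree_on_lines_le d (\<lambda>a. q a b)) \<and> (\<forall>a b. bez a b = 0 \<longrightarrow> q a b = 0)"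

lemma bez_swap: "bez a b = (-1) ^ d * bez b a"
  by (rule bezout_det_swap)

lemma chow_vanishing_swap: "chow_vanishing q \<Longrightarrow> chow_vanishing (\<lambda>a b. q b a)"
  unfolding chow_vanishing_def using bez_swap by (metis mult_zero_right)

lemma chow_vanishing_ceval:
  assumes "bihomogeneous d d Q" "\<And>a b. bez a b = 0 \<Longrightarrow> ceval (case_sum a b) Q = 0"
  shows "chow_vanishing (\<lambda>a b. ceval (case_sum a b) Q)"
  unfolding chow_vanishing_def
  using degree_on_lines_le_ceval_left[OF assms(1)] degree_on_lines_le_ceval_right[OF assms(1)]
    assms(2) by blast

lemma chow_vanishing_bez: "chow_vanishing bez"
  using chow_vanishing_ceval[OF bihomogeneous_chow_form] by (simp add: ceval_chow_form)

lemma chow_vanishing_poly_on_lines: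
  assumes "chow_vanishing q"
  shows "poly_on_lines (\<lambda>a. q a b)"
  using assms degree_on_lines_le_imp_poly_on_lines unfolding chow_vanishing_def by blast

lemma chow_vanishing_proportional_generic:
  assumes q: "chow_vanishing q" and a: "ceval a discr \<noteq> 0"
  shows "q a b * bez a (coord_form o\<^sub>0) = bez a b * q a (coord_form o\<^sub>0)"
proof (rule proportional_if_vanishing_on_hyperplanes)
  let ?U = "\<gamma> ` {t. dotp a (\<gamma> t) = 0}"
  show "finite ?U"
    using a finite_hyperplane_parameters by (simp add: ceval_discr_nonzero_iff)
  show "dotp (coord_form o\<^sub>0) u = 1" if "u \<in> ?U" for u
    using that by (auto simp: \<gamma>_o_eq_1)
  have "card ?U = d"
    using inj_on_subset[OF inj_\<gamma>] card_hyperplane_parameters[OF a] by (simp add: card_image)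
  then show "degree_on_lines_le (card ?U) (q a)" "degree_on_lines_le (card ?U) (bez a)"
    using q chow_vanishing_bez unfolding chow_vanishing_def by simp_all
  show "bez a b = 0" if "u \<in> ?U" "dotp b u = 0" for u b
    using that unfolding bez_eq_0_iff by blast
  then show "q a b = 0" if "u \<in> ?U" "dotp b u = 0" for u b
    using that q unfolding chow_vanishing_def by blast
qed

lemma chow_vanishing_proportional:
  assumes q: "chow_vanishing q"
  shows "q a b * bez a b' = bez a b * q a b'"
proof -
  obtain a' where a': "ceval a' discr \<noteq> 0" using ceval_discr_nonzero_ex by blast
  have "q a b * bez a b' - bez a b * q a b' = 0"
  proof (rule poly_on_lines_eq_0[where f = "\<lambda>a. q a b * bez a b' - bez a b * q a b'"
        and g = "\<lambda>a. ceval a discr"])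
    show "poly_on_lines (\<lambda>a. q a b * bez a b' - bez a b * q a b')"
      using chow_vanishing_poly_on_lines[OF q] chow_vanishing_poly_on_lines[OF chow_vanishing_bez]
      by (intro poly_on_lines_diff poly_on_lines_mult)
    show "poly_on_lines (\<lambda>a. ceval a discr)" by (rule poly_on_lines_ceval)
    show "ceval a' discr \<noteq> 0" by (rule a')
  next
    fix a assume a: "ceval a discr \<noteq> 0"
    let ?e = "coord_form o\<^sub>0 :: 'v \<Rightarrow> complex"
    have "(q a b * bez a ?e) * bez a b' = bez a b * (q a b' * bez a ?e)"
      unfolding chow_vanishing_proportional_generic[OF q a] by simp
    moreover have "bez a ?e \<noteq> 0"
      using a bez_coord_form_nonzero by (simp add: ceval_discr_nonzero_iff)
    ultimately show "q a b * bez a b' - bez a b * q a b' = 0" by simp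
  qed
  then show ?thesis by simp
qed

lemma chow_vanishing_multiple:
  assumes q: "chow_vanishing q"
  shows "\<exists>k. \<forall>a b. q a b = k * bez a b"
proof -
  let ?e = "coord_form o\<^sub>0 :: 'v \<Rightarrow> complex"
  obtain a\<^sub>0 where a\<^sub>0: "bez a\<^sub>0 ?e \<noteq> 0" using bez_nonzero_ex by blast
  have "q a b * bez a\<^sub>0 ?e - bez a b * q a\<^sub>0 ?e = 0" for a b
  proof (rule poly_on_lines_eq_0[where f = "\<lambda>a. q a b * bez a\<^sub>0 ?e - bez a b * q a\<^sub>0 ?e"
        and g = "\<lambda>a. bez a ?e"])
    show "poly_on_lines (\<lambda>a. q a b * bez a\<^sub>0 ?e - bez a b * q a\<^sub>0 ?e)"
      using chow_vanishing_poly_on_lines[OF q] chow_vanishing_poly_on_lines[OF chow_vanishing_bez]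
      by (intro poly_on_lines_diff poly_on_lines_mult poly_on_lines_const)
    show "poly_on_lines (\<lambda>a. bez a ?e)"
      by (rule chow_vanishing_poly_on_lines[OF chow_vanishing_bez])
    show "bez a\<^sub>0 ?e \<noteq> 0" by (rule a\<^sub>0)
  next
    fix a assume a: "bez a ?e \<noteq> 0"
    have proportional_in_b: "q a b * bez a ?e = bez a b * q a ?e"
      by (rule chow_vanishing_proportional[OF q])
    have "q a ?e * bez ?e a\<^sub>0 = bez ?e a * q a\<^sub>0 ?e"
      by (rule chow_vanishing_proportional[OF chow_vanishing_swap[OF q]])
    then have proportional_in_a: "q a ?e * bez a\<^sub>0 ?e = bez a ?e * q a\<^sub>0 ?e"
      unfolding bez_swap[of ?e] by simp
    have "(q a b * bez a ?e) * bez a\<^sub>0 ?e = bez a b * (q a ?e * bez a\<^sub>0 ?e)"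
      unfolding proportional_in_b by simp
    also have "\<dots> = bez a b * q a\<^sub>0 ?e * bez a ?e" unfolding proportional_in_a by simp
    finally show "q a b * bez a\<^sub>0 ?e - bez a b * q a\<^sub>0 ?e = 0" using a by simp
  qed
  then have "q a b = q a\<^sub>0 ?e / bez a\<^sub>0 ?e * bez a b" for a b
    using a\<^sub>0 by (simp add: field_simps)
  then show ?thesis by blast
qed

lemma chow_point_multiple:
  assumes "Q \<in> chow_point curve"
  obtains k where "Q = cconst k * chow_form"
proof -
  have bi: "bihomogeneous d d Q" and zeros: "biproj_zeros Q = biproj_zeros chow_form"
    using assms has_degree_unique[OF has_degree_curve] biproj_zeros_chow_form
    by (auto simp: chow_point_def)
  have "ceval (case_sum a b) Q = 0" if "bez a b = 0" for a b
  proof (cases "a = (\<lambda>_. 0) \<or> b = (\<lambda>_. 0)")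
    case True
    have "ceval (case_sum (\<lambda>i. 0 * a i) (\<lambda>i. 1 * b i)) Q = 0"
      "ceval (case_sum (\<lambda>i. 1 * a i) (\<lambda>i. 0 * b i)) Q = 0"
      unfolding ceval_bihomogeneous_scale[OF bi] using d_pos by simp_all
    then show ?thesis using True by (elim disjE) simp_all
  next
    case False
    then have "(proj_pt a, proj_pt b) \<in> biproj_zeros chow_form"
      using that
      unfolding proj_pt_in_biproj_zeros[OF bihomogeneous_chow_form] ceval_chow_form by simp
    then show ?thesis
      unfolding zeros[symmetric] proj_pt_in_biproj_zeros[OF bi] by simp
  qed
  then obtain k where k: "\<And>a b. ceval (case_sum a b) Q = k * bez a b"
    using chow_vanishing_multiple[OF chow_vanishing_ceval[OF bi]] by blast
  have "ceval x Q = ceval x (cconst k * chow_form)" for x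
  proof -
    have x: "x = case_sum (x \<circ> Inl) (x \<circ> Inr)" by (auto simp: fun_eq_iff split: sum.split)
    show ?thesis
      by (subst (1 2) x) (simp only: k ceval_mult ceval_cconst ceval_chow_form)
  qed
  then show ?thesis using ceval_ext that by blast
qed

theorem chow_point_curve: "chow_point curve = cpoly_class chow_form"
proof (intro equalityI subsetI)
  fix Q assume Q: "Q \<in> chow_point curve"
  then obtain k where k: "Q = cconst k * chow_form" by (rule chow_point_multiple)
  moreover have "Q \<noteq> 0" using Q by (simp add: chow_point_def)
  ultimately have "k \<noteq> 0" by (auto simp: cconst_def)
  then show "Q \<in> cpoly_class chow_form" using k by (auto simp: cpoly_class_def)
next
  fix Q assume "Q \<in> cpoly_class chow_form"
  then obtain k where k: "k \<noteq> 0" "Q = cconst k * chow_form" by (auto simp: cpoly_class_def)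
  then show "Q \<in> chow_point curve"
    using chow_form_in_chow_point by (auto intro: chow_point_scale)
qed

end

section \<open>Locally nilpotent derivations\<close>

lemma suminf_coeff_eq_poly:
  fixes p :: "'a::{comm_semiring_1, t2_space} poly"
  shows "suminf (\<lambda>j. coeff p j * s ^ j) = poly p s"
  unfolding poly_altdef by (rule suminf_finite) (auto simp: coeff_eq_0)

locale lnd =
  fixes \<delta> :: "('n::finite) cpoly \<Rightarrow> 'n cpoly"
  assumes derivation: "derivation \<delta>" and nilpotent: "locally_nilpotent \<delta>"
begin

lemma \<delta>_add: "\<delta> (p + q) = \<delta> p + \<delta> q"
  and \<delta>_scale: "\<delta> (cconst k * p) = cconst k * \<delta> p"
  and \<delta>_mult: "\<delta> (p * q) = \<delta> p * q + p * \<delta> q"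
  using derivation by (auto simp: derivation_def)

lemma \<delta>_0: "\<delta> 0 = 0"
  using \<delta>_add[of 0 0] by simp

lemma \<delta>_cconst: "\<delta> (cconst k) = 0"
  using \<delta>_mult[of 1 1] \<delta>_scale[of k 1] by simp

lemma funpow_\<delta>_0: "(\<delta> ^^ m) 0 = 0"
  by (induction m) (simp_all add: \<delta>_0)

lemma funpow_\<delta>_add: "(\<delta> ^^ m) (p + q) = (\<delta> ^^ m) p + (\<delta> ^^ m) q"
  by (induction m) (simp_all add: \<delta>_add)

lemma funpow_\<delta>_cconst: "m > 0 \<Longrightarrow> (\<delta> ^^ m) (cconst k) = 0"
  by (cases m) (simp_all add: funpow_Suc_right \<delta>_cconst funpow_\<delta>_0 del: funpow.simps(2))

lemma funpow_\<delta>_eq_0_mono: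
  assumes "(\<delta> ^^ l) p = 0" "l \<le> m"
  shows "(\<delta> ^^ m) p = 0"
proof -
  have "(\<delta> ^^ m) p = (\<delta> ^^ (m - l)) ((\<delta> ^^ l) p)"
    using assms(2) by (simp flip: comp_apply[of "\<delta> ^^ _"] funpow_add)
  then show ?thesis by (simp add: assms(1) funpow_\<delta>_0)
qed

lemma funpow_\<delta>_cvar_eq_0:
  assumes "l > lnd_degree \<delta>"
  shows "(\<delta> ^^ l) (cvar j) = 0"
proof -
  have "\<exists>m. \<forall>j. (\<delta> ^^ m j) (cvar j) = 0"
    by (rule choice) (use nilpotent in \<open>simp add: locally_nilpotent_def\<close>)
  then obtain m where m: "\<And>j. (\<delta> ^^ m j) (cvar j) = 0" by blast
  have "\<forall>j. (\<delta> ^^ (Max (range m) + 1)) (cvar j) = 0"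
    using funpow_\<delta>_eq_0_mono[OF m] by (simp add: le_SucI del: funpow.simps)
  then have "\<forall>j. (\<delta> ^^ (lnd_degree \<delta> + 1)) (cvar j) = 0"
    unfolding lnd_degree_def by (rule LeastI)
  then show ?thesis
    using funpow_\<delta>_eq_0_mono[of "lnd_degree \<delta> + 1"] assms by auto
qed

text \<open>The polynomial \<open>t \<mapsto> p(-t.x)\<close>.\<close>

definition orbit_poly :: "('n \<Rightarrow> complex) \<Rightarrow> 'n cpoly \<Rightarrow> complex poly" where
  "orbit_poly x p = Abs_poly (\<lambda>j. ceval x ((\<delta> ^^ j) p) / fact j)"

lemma coeff_orbit_poly: "coeff (orbit_poly x p) j = ceval x ((\<delta> ^^ j) p) / fact j"
proof -
  obtain m where "(\<delta> ^^ m) p = 0" using nilpotent unfolding locally_nilpotent_def by blast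
  then have "ceval x ((\<delta> ^^ j) p) / fact j = 0" if "j > m" for j
    using funpow_\<delta>_eq_0_mono[of m p j] that by simp
  then show ?thesis unfolding orbit_poly_def by (subst coeff_Abs_poly[of m]) auto
qed

lemma orbit_poly_add: "orbit_poly x (p + q) = orbit_poly x p + orbit_poly x q"
  by (rule poly_eqI) (simp add: coeff_orbit_poly funpow_\<delta>_add ceval_add add_divide_distrib)

lemma orbit_poly_cconst: "orbit_poly x (cconst k) = [:k:]"
  by (rule poly_eqI)
    (auto simp: coeff_orbit_poly coeff_pCons funpow_\<delta>_cconst simp del: funpow.simps(2)
      split: nat.split)

lemma orbit_poly_1: "orbit_poly x 1 = 1"
  using orbit_poly_cconst[of x 1] by (simp add: cconst_1)

lemma pderiv_orbit_poly: "pderiv (orbit_poly x p) = orbit_poly x (\<delta> p)"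
  by (rule poly_eqI)
    (simp add: coeff_pderiv coeff_orbit_poly funpow_Suc_right field_simps
      del: funpow.simps(2) of_nat_Suc)

text \<open>Both sides satisfy the product rule, so their coefficients agree by induction.\<close>

lemma orbit_poly_mult: "orbit_poly x (p * q) = orbit_poly x p * orbit_poly x q"
proof (rule poly_eqI)
  fix m
  show "coeff (orbit_poly x (p * q)) m = coeff (orbit_poly x p * orbit_poly x q) m"
  proof (induction m arbitrary: p q)
    case 0
    show ?case by (simp add: coeff_mult coeff_orbit_poly ceval_mult)
  next
    case (Suc m)
    have "of_nat (Suc m) * coeff (orbit_poly x (p * q)) (Suc m) =
        coeff (pderiv (orbit_poly x (p * q))) m"
      by (simp only: coeff_pderiv)
    also have "\<dots> = coeff (orbit_poly x (\<delta> p * q)) m + coeff (orbit_poly x (p * \<delta> q)) m"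
      by (simp add: pderiv_orbit_poly \<delta>_mult orbit_poly_add)
    also have "\<dots> = coeff (pderiv (orbit_poly x p * orbit_poly x q)) m"
      by (simp add: Suc.IH pderiv_mult pderiv_orbit_poly mult.commute add.commute)
    also have "\<dots> = of_nat (Suc m) * coeff (orbit_poly x p * orbit_poly x q) (Suc m)"
      by (simp only: coeff_pderiv)
    finally show ?case by (simp del: of_nat_Suc)
  qed
qed

lemma poly_orbit_poly: "poly (orbit_poly x p) t = ceval (\<lambda>j. poly (orbit_poly x (cvar j)) t) p"
proof (rule ring_hom_eq_ceval)
  have "orbit_poly x 0 = 0" using orbit_poly_cconst[of x 0] by (simp add: cconst_def)
  then show "comm_ring_hom (\<lambda>p. poly (orbit_poly x p) t)"
    by unfold_locales (simp_all add: orbit_poly_add orbit_poly_mult orbit_poly_1)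
qed (simp add: orbit_poly_cconst)

abbreviation orbit_coords :: "('n \<Rightarrow> complex) \<Rightarrow> 'n option \<Rightarrow> complex poly" where
  "orbit_coords x \<equiv> \<lambda>j. orbit_poly x (coord j)"

lemma degree_orbit_poly_coord: "degree (orbit_poly x (coord j)) \<le> lnd_degree \<delta>"
proof (cases j)
  case None
  then show ?thesis by (simp add: coord_def orbit_poly_1)
next
  case (Some i)
  then show ?thesis
    by (intro degree_le) (simp add: coord_def coeff_orbit_poly funpow_\<delta>_cvar_eq_0)
qed

lemma lnd_action_eq: "lnd_action \<delta> t x j = poly (orbit_poly x (cvar j)) (- t)"
  unfolding lnd_action_def suminf_coeff_eq_poly[symmetric]
  by (simp add: coeff_orbit_poly mult.commute)

lemma affine_embed_lnd_action:
  "affine_embed (lnd_action \<delta> t x) = proj_pt (\<lambda>j. poly (orbit_poly x (coord j)) (- t))"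
  unfolding affine_embed_def
  by (rule arg_cong[where f = proj_pt])
    (simp add: fun_eq_iff coord_def lnd_action_eq orbit_poly_1 split: option.split)

lemma lnd_degree_pos:
  assumes "free_action (lnd_action \<delta>)"
  shows "lnd_degree \<delta> > 0"
proof (rule ccontr)
  assume "\<not> lnd_degree \<delta> > 0"
  then have "degree (orbit_poly x (cvar j)) = 0" for x j
    using degree_orbit_poly_coord[of x "Some j"] by (simp add: coord_def)
  then have "poly (orbit_poly x (cvar j)) 1 = poly (orbit_poly x (cvar j)) 0" for x j
    by (metis degree_0_id poly_const_conv)
  then have "lnd_action \<delta> (-1) x = x" for x
    by (simp add: fun_eq_iff lnd_action_eq poly_0_coeff_0 coeff_orbit_poly)
  then show False
    using assms unfolding free_action_def by (metis neg_equal_0_iff_equal zero_neq_one)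
qed

text \<open>The function \<open>\<delta>\<^sup>d\<^sup>-\<^sup>1 x\<^sub>k\<close> restricts to a nonconstant affine function of \<open>t\<close> on the orbit.\<close>

lemma inj_orbit:
  assumes degree_pos: "lnd_degree \<delta> > 0" and generic: "ceval x ((\<delta> ^^ lnd_degree \<delta>) (cvar k)) \<noteq> 0"
  shows "inj (\<lambda>t j. poly (orbit_poly x (cvar j)) t)"
proof (rule injI)
  fix s t assume eq: "(\<lambda>j. poly (orbit_poly x (cvar j)) s) = (\<lambda>j. poly (orbit_poly x (cvar j)) t)"
  obtain e where e: "lnd_degree \<delta> = Suc e" using degree_pos by (cases "lnd_degree \<delta>") auto
  let ?p = "(\<delta> ^^ e) (cvar k)"
  have pow: "(\<delta> ^^ j) ?p = (\<delta> ^^ (e + j)) (cvar k)" for j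
    by (subst add.commute) (simp add: funpow_add)
  have "orbit_poly x ?p = [:ceval x ?p, ceval x ((\<delta> ^^ lnd_degree \<delta>) (cvar k)):]"
  proof (rule poly_eqI)
    fix j :: nat
    consider "j = 0" | "j = 1" | "j > 1" by linarith
    then show "coeff (orbit_poly x ?p) j =
        coeff [:ceval x ?p, ceval x ((\<delta> ^^ lnd_degree \<delta>) (cvar k)):] j"
      unfolding coeff_orbit_poly pow
      by cases (auto simp: e coeff_pCons funpow_\<delta>_cvar_eq_0 split: nat.split)
  qed
  moreover have "poly (orbit_poly x ?p) s = poly (orbit_poly x ?p) t"
    unfolding poly_orbit_poly[of x ?p] eq ..
  ultimately show "s = t" using generic by simp
qed

lemma poly_curve_orbit:
  assumes "free_action (lnd_action \<delta>)" and generic: "ceval x ((\<delta> ^^ lnd_degree \<delta>) (cvar k)) \<noteq> 0"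
  shows "poly_curve (orbit_coords x) (lnd_degree \<delta>) None"
proof
  show "degree (orbit_poly x (coord j)) \<le> lnd_degree \<delta>" for j by (rule degree_orbit_poly_coord)
  have "coeff_vec (orbit_coords x) (lnd_degree \<delta>) (Some k) \<noteq> 0"
    using generic by (simp add: coeff_vec_def coeff_orbit_poly coord_def)
  then show "coeff_vec (orbit_coords x) (lnd_degree \<delta>) \<noteq> (\<lambda>_. 0)" by auto
  show "orbit_poly x (coord None) = 1" by (simp add: coord_def orbit_poly_1)
  show "inj (\<lambda>t j. poly (orbit_poly x (coord j)) t)"
  proof (rule injI)
    fix s t
    assume "(\<lambda>j. poly (orbit_poly x (coord j)) s) = (\<lambda>j. poly (orbit_poly x (coord j)) t)"
    then have "(\<lambda>j. poly (orbit_poly x (cvar j)) s) = (\<lambda>j. poly (orbit_poly x (cvar j)) t)"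
      by (auto simp: coord_def fun_eq_iff split: option.splits)
    then show "s = t" using inj_orbit[OF lnd_degree_pos[OF assms(1)] generic] by (simp add: inj_def)
  qed
qed

lemma orbit_closure_eq_curve:
  assumes "poly_curve (orbit_coords x) d None"
  shows "orbit_closure \<delta> x = poly_curve.curve (orbit_coords x) d"
proof -
  interpret poly_curve "orbit_coords x" d None by fact
  have "affine_embed ` range (\<lambda>t. lnd_action \<delta> t x) = (\<lambda>t. proj_pt (\<gamma> t)) ` range uminus"
    unfolding image_image by (simp add: affine_embed_lnd_action \<gamma>_def)
  then show ?thesis unfolding orbit_closure_def closure_curve[symmetric] by simp
qed

lemma linear_form_funpow_\<delta>:
  fixes f :: "'n option \<Rightarrow> 'v"
  shows "(\<Sum>j\<in>UNIV. cvar (f j) * cconst (ceval x ((\<delta> ^^ l) (coord j)))) =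
    of_nat (fact l) * lin_form f (coeff_vec (orbit_coords x) l)"
proof -
  have "(cconst (ceval x ((\<delta> ^^ l) (coord j))) :: 'v cpoly) =
      of_nat (fact l) * cconst (coeff_vec (orbit_coords x) l j)" for j
    by (simp add: coeff_vec_def coeff_orbit_poly flip: cconst_of_nat cconst_mult)
  then show ?thesis
    by (simp only: lin_form_def sum_distrib_left mult.left_commute[of "of_nat (fact l)"])
qed

lemma F_entry_eq_bezout_entry:
  assumes "l \<le> d"
  shows "F_entry \<delta> d x l k = of_nat (fact d * fact k) *
    bezout_entry d (\<lambda>l. lin_form Inl (coeff_vec (orbit_coords x) l))
      (\<lambda>l. lin_form Inr (coeff_vec (orbit_coords x) l)) l k"
  unfolding F_entry_def f_entry_def alpha_form_def beta_form_def linear_form_funpow_\<delta>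
  by (rule falling_sum_eq_bezout_entry) (rule assms)

lemma cpoly_class_P_poly:
  assumes "poly_curve (orbit_coords x) d None"
  shows "cpoly_class (P_poly \<delta> d x) =
    cpoly_class (poly_curve.chow_form (orbit_coords x) d)"
proof -
  interpret poly_curve "orbit_coords x" d None by fact
  let ?s = "\<lambda>k. fact d * fact k :: nat"
  let ?entry = "bezout_entry d (\<lambda>l. lin_form Inl (coeff_vec (orbit_coords x) l))
    (\<lambda>l. lin_form Inr (coeff_vec (orbit_coords x) l))"
  have "mat d d (\<lambda>(i, k). F_entry \<delta> d x (i + 1) k) =
      mat d d (\<lambda>(i, k). of_nat (?s k) * ?entry (i + 1) k)"
    by (rule eq_matI) (auto simp: F_entry_eq_bezout_entry)
  then have "P_poly \<delta> d x = (\<Prod>k<d. of_nat (?s k)) * chow_form"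
    unfolding P_poly_def chow_form_def bezout_det_def det_scale_columns[symmetric] by simp
  also have "(\<Prod>k<d. of_nat (?s k)) = cconst (of_nat (\<Prod>k<d. ?s k))"
    by (simp only: cconst_of_nat flip: of_nat_prod)
  finally show ?thesis by (simp add: cpoly_class_scale del: of_nat_prod)
qed

end

theorem theorem1:
  fixes \<delta> :: "('n::finite) cpoly \<Rightarrow> 'n cpoly"
    and d :: nat
    and x :: "'n \<Rightarrow> complex"
  assumes "derivation \<delta>"
    and "locally_nilpotent \<delta>"
    and "free_action (lnd_action \<delta>)"
    and "d = lnd_degree \<delta>"
    and "\<exists>j. ceval x ((\<delta> ^^ d) (cvar j)) \<noteq> 0"
  shows "chow_point (orbit_closure \<delta> x) = cpoly_class (P_poly \<delta> d x)"
proof -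
  interpret lnd \<delta> using assms(1,2) by unfold_locales
  have curve: "poly_curve (orbit_coords x) d None"
    using poly_curve_orbit assms(3-5) by blast
  then show ?thesis
    using poly_curve.chow_point_curve[OF curve]
    by (simp add: orbit_closure_eq_curve[OF curve] cpoly_class_P_poly[OF curve])
qed

end
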